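(* Let $\beta>-d/2$ and $f\not\equiv\mathbf{1}_W$. If $n^2 r_n^d\to\infty$ as $n\to\infty$, then $$T_{e,n}(\beta) \overset{\mathbb{P}}{\longrightarrow} \infty \quad \text{and} \quad T_{a,n}(\beta) \overset{\mathbb{P}}{\longrightarrow}\infty \quad \text{as} \quad n\to\infty.$$
   Context: Let $d\ge 1$ and let $W\subset\mathbb{R}^d$ be a measurable set with volume (Lebesgue measure) $\operatorname{Vol}(W)=1$. Let $f$ be a probability density on $\mathbb{R}^d$ whose support is contained in $W$. For $n\ge 2$ let $\mathscr{X}_n=\{X_1,\ldots,X_n\}$, where $X_1,\ldots,X_n$ are i.i.d. random vectors with density $f$. Let $(r_n)$ be a sequence of positive real numbers with $r_n\to0$ as $n\to\infty$. For $\beta\in\mathbb{R}$ define $$L_n(\beta):=\frac12\sum_{(x,y)\in\mathscr{X}^2_{n,\neq}}\mathbf{1}\{\|x-y\|\le r_n\}\,\|x-y\|^\beta,$$ where the sum is over all ordered pairs of distinct points of $\mathscr{X}_n$, $\|\cdot\|$ is the Euclidean norm and $\mathbf{1}\{\cdot\}$ is the indicator. $\kappa_d=\pi^{d/2}/\Gamma(d/2+1)$ is the volume of the $d$-dimensional unit ball. For $\beta>-d/2$ the test statistics are $$T_{e,n}(\beta)=\left(\frac{L_n(\beta)- \frac{1}{2}n(n-1)\int_{W^2} \mathbf{1}\{\|x-y\|\leq r_n\} \, \|x-y\|^\beta\, \mathrm{d}(x,y)}{\sqrt{\frac{d\kappa_d}{2(2\beta+d)} }\,n r_n^{\beta+d/2}}\right)^2,$$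 $$T_{a,n}(\beta)=\left(\frac{L_n(\beta)-\frac{d\kappa_d}{2(\beta+d)} \, n(n-1) r_n^{\beta+d}}{\sqrt{\frac{d\kappa_d}{2(2\beta+d)} }\,n r_n^{\beta+d/2}}\right)^2.$$ $f\not\equiv\mathbf{1}_W$ means that $f$ is not almost everywhere equal on $W$ to the indicator function $\mathbf{1}_W$ of $W$. $\overset{\mathbb{P}}{\longrightarrow}\infty$ denotes convergence in probability to infinity, i.e. for every $K>0$ the probability that the random variable exceeds $K$ tends to $1$. *)

theory Defs
  imports "HOL-Probability.Probability"
begin

definition edge_term :: "real \<Rightarrow> real \<Rightarrow> 'a::euclidean_space \<Rightarrow> 'a \<Rightarrow> real" where
  "edge_term \<beta> r x y = of_bool (norm (x - y) \<le> r) * norm (x - y) powr \<beta>"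

text \<open>\<open>L\<^sub>n(\<beta>)\<close> as a function of the (finite) point set \<open>S\<close>, summing over ordered pairs of
  distinct points.\<close>

definition edge_functional :: "real \<Rightarrow> real \<Rightarrow> 'a::euclidean_space set \<Rightarrow> real" where
  "edge_functional \<beta> r S =
     1 / 2 * (\<Sum>(x, y) \<in> {(x, y). x \<in> S \<and> y \<in> S \<and> x \<noteq> y}. edge_term \<beta> r x y)"

text \<open>The common denominator of the two test statistics in dimension \<open>d\<close>;
  the library constant \<^const>\<open>unit_ball_vol\<close> is \<open>\<kappa>\<^sub>d\<close>.\<close>

definition test_scale :: "nat \<Rightarrow> real \<Rightarrow> real \<Rightarrow> nat \<Rightarrow> real" where
  "test_scale d \<beta> r n =
     sqrt (real d * unit_ball_vol (real d) / (2 * (2 * \<beta> + real d))) *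
     real n * r powr (\<beta> + real d / 2)"

text \<open>The integral is taken over the completed measure on \<open>'a \<times> 'a\<close>, since \<open>W\<close> is only assumed
  Lebesgue measurable.  The value \<open>0 powr \<beta> = 0\<close> on the diagonal is immaterial, the diagonal
  being a null set.\<close>

definition T_e ::
  "'a::euclidean_space set \<Rightarrow> real \<Rightarrow> real \<Rightarrow> nat \<Rightarrow> 'a set \<Rightarrow> real" where
  "T_e W \<beta> r n S =
     ((edge_functional \<beta> r S -
         1 / 2 * real n * (real n - 1) * (LINT (x, y):W \<times> W|lebesgue. edge_term \<beta> r x y)) /
      test_scale DIM('a) \<beta> r n)\<^sup>2"

definition T_a ::
  "real \<Rightarrow> real \<Rightarrow> nat \<Rightarrow> 'a::euclidean_space set \<Rightarrow> real" where
  "T_a \<beta> r n S =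
     ((edge_functional \<beta> r S -
         real DIM('a) * unit_ball_vol (real DIM('a)) / (2 * (\<beta> + real DIM('a))) *
         real n * (real n - 1) * r powr (\<beta> + real DIM('a))) /
      test_scale DIM('a) \<beta> r n)\<^sup>2"

definition tends_to_infinity_in_prob :: "'w measure \<Rightarrow> (nat \<Rightarrow> 'w \<Rightarrow> real) \<Rightarrow> bool" where
  "tends_to_infinity_in_prob M Y \<longleftrightarrow>
     (\<forall>K>0. (\<lambda>n. measure M {\<omega> \<in> space M. Y n \<omega> > K}) \<longlonglongrightarrow> 1)"

end

theory Submission
  imports Defs
begin

text \<open>
  Under the alternative the edge functional is too large by a constant factor.  Write \<open>a\<^sub>n\<close> for the
  integral of \<open>\<parallel>z\<parallel>\<^sup>\<beta>\<close> over the ball of radius \<open>r\<^sub>n\<close>.  The centering of \<open>T\<^sub>a\<close> is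
  \<open>n (n - 1) a\<^sub>n / 2\<close>, and that of \<open>T\<^sub>e\<close> is at most this
  (\<open>set_integral_edge_term_le\<close>).  For square integrable \<open>f\<close>, on the other hand, the expectation of
  \<open>L\<^sub>n(\<beta>)\<close> is asymptotically \<open>n (n - 1) a\<^sub>n / 2\<close> times \<open>\<integral>f\<^sup>2\<close>, and \<open>\<integral>f\<^sup>2 > 1\<close> by the equality case
  of the Cauchy-Schwarz inequality, since \<open>f\<close> is not the uniform density on the set \<open>W\<close> of measure
  one (\<open>density_square_integral_gt_1\<close>).  So both statistics tend to infinity as soon as \<open>L\<^sub>n(\<beta>)\<close>
  concentrates from below and its excess dominates the denominator.

  As \<open>f\<close> need not be bounded or square integrable, only the edges between points with \<open>f \<le> m\<close> are
  kept; this decreases \<open>L\<^sub>n(\<beta>)\<close>, and \<open>m\<close> is chosen such that the truncated density \<open>g\<close> still satisfies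
  \<open>\<integral>g\<^sup>2 > c > 1\<close> (\<open>truncated_square_integral\<close>).  The mean edge weight is the integral
  of the autocorrelation \<open>\<integral>g(x) g(x + z) dx\<close> against \<open>\<parallel>z\<parallel>\<^sup>\<beta>\<close> on the ball of radius \<open>r\<^sub>n\<close>.  By the continuity of
  translations in \<open>L\<^sup>1\<close> (\<open>L1_translation_continuous\<close>) the autocorrelation is at least \<open>c\<close> near
  the origin, so that the mean is at least \<open>c a\<^sub>n\<close> once \<open>r\<^sub>n\<close> is small.

  The variance of the sum over pairs is at most of order
  \<open>n\<^sup>2 \<integral>\<parallel>z\<parallel>\<^bsup>2\<beta>\<^esup> + n\<^sup>3 a\<^sub>n\<^sup>2\<close>, with the integral over the same ball, because only index
  pairs with a common index are correlated
  (\<open>pair_sum_lower_tail\<close>).  Here \<open>\<beta> > -d/2\<close> makes the integral finite, and it is proportional to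
  \<open>\<sigma>\<^sub>n\<^sup>2 / n\<^sup>2\<close>, where \<open>\<sigma>\<^sub>n\<close> is the denominator of the statistics.  Relative to the squared excess of order
  \<open>(n\<^sup>2 a\<^sub>n)\<^sup>2\<close> the variance is therefore at most of order \<open>(\<sigma>\<^sub>n / (n\<^sup>2 a\<^sub>n))\<^sup>2 + 1/n\<close>, and
  \<open>n\<^sup>2 a\<^sub>n / \<sigma>\<^sub>n\<close> is of order \<open>n r\<^sub>n\<^bsup>d/2\<^esup>\<close>, which tends to infinity
  (\<open>signal_to_noise_at_top\<close>).  By Chebyshev's inequality \<open>L\<^sub>n(\<beta>)\<close> exceeds both centerings by any
  multiple of \<open>\<sigma>\<^sub>n\<close> with probability tending to one.
\<close>

section \<open>Radial integrals with respect to Lebesgue measure\<close>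

lemma has_integral_indicator_mult_UNIV:
  fixes u :: "real \<Rightarrow> real"
  assumes "(u has_integral I) S"
  shows "((\<lambda>x. indicator S x * u x) has_integral I) UNIV"
proof -
  have "(\<lambda>x. indicator S x * u x) = (\<lambda>x. if x \<in> S then u x else 0)"
    by (auto simp: indicator_def)
  then show ?thesis using assms by (simp add: has_integral_restrict_UNIV)
qed

text \<open>Polar coordinates for radial functions: the two measures give the mass \<open>\<kappa>\<^sub>d t\<^sup>d\<close> of a centred
ball to every half-line \<open>{..t}\<close> with \<open>t \<ge> 0\<close>, and half-lines generate the Borel sets.\<close>

lemma distr_norm_lborel:
  "distr lborel borel (norm :: 'a::euclidean_space \<Rightarrow> real) =
     density lborel (\<lambda>t. ennreal (indicator {0..} t *
       (real DIM('a) * unit_ball_vol (real DIM('a)) * t ^ (DIM('a) - 1))))"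
    (is "?D = ?E")
proof (rule measure_eqI_generator_eq[where E = "range atMost" and \<Omega> = UNIV and A = "\<lambda>i. {..real i}"])
  define d where "d = DIM('a)"
  have d: "d \<ge> 1" by (simp add: d_def Suc_leI)
  have D: "emeasure ?D {..t} = ennreal (if t < 0 then 0 else unit_ball_vol (real d) * t ^ d)" for t
  proof -
    have "emeasure ?D {..t} = emeasure lborel {x::'a. norm x \<le> t}"
      by (subst emeasure_distr) (auto simp: vimage_def)
    also have "{x::'a. norm x \<le> t} = (if t < 0 then {} else cball 0 t)"
      by (auto simp: cball_def intro: order_less_le_trans dest: order_trans[OF norm_ge_zero])
    finally show ?thesis by (auto simp: emeasure_cball d_def)
  qed
  have E: "emeasure ?E {..t} = ennreal (if t < 0 then 0 else unit_ball_vol (real d) * t ^ d)" for t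
  proof -
    have "emeasure ?E {..t} = (\<integral>\<^sup>+ s. ennreal (indicator {0..t} s *
        (real d * unit_ball_vol (real d) * s ^ (d - 1))) \<partial>lborel)"
      by (subst emeasure_density)
         (auto simp: d_def indicator_def intro!: nn_integral_cong)
    also have "\<dots> = ennreal (if t < 0 then 0 else unit_ball_vol (real d) * t ^ d)"
    proof (cases "t < 0")
      case True
      then show ?thesis by simp
    next
      case False
      have "((\<lambda>s. real d * unit_ball_vol (real d) * s ^ (d - 1)) has_integral
          unit_ball_vol (real d) * t ^ d - unit_ball_vol (real d) * 0 ^ d) {0..t}"
        using False d
        by (intro fundamental_theorem_of_calculus)
           (auto intro!: derivative_eq_intros simp flip: has_real_derivative_iff_has_vector_derivative)
      then have "((\<lambda>s. indicator {0..t} s * (real d * unit_ball_vol (real d) * s ^ (d - 1)))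
          has_integral unit_ball_vol (real d) * t ^ d) UNIV"
        using d by (intro has_integral_indicator_mult_UNIV) (simp add: power_0_left)
      then show ?thesis using False
        by (subst nn_integral_has_integral_lborel) (auto simp: indicator_def)
    qed
    finally show ?thesis .
  qed
  show "emeasure ?D X = emeasure ?E X" if "X \<in> range atMost" for X
    using that D E by auto
  show "Int_stable (range atMost :: real set set)"
    by (auto intro!: Int_stableI)
  show "sets ?D = sigma_sets UNIV (range atMost)" "sets ?E = sigma_sets UNIV (range atMost)"
    by (simp_all add: borel_eq_atMost)
  show "emeasure ?D {..real i} \<noteq> \<infinity>" for i
    using D by simp
  show "(\<Union>i. {..real i}) = UNIV"
    using real_arch_simple by auto
qed auto

text \<open>The exact constant matters: it is the centering of the second test statistic, and, applied with
the exponent \<open>2\<beta>\<close>, it yields the normalising variance.\<close>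

lemma nn_integral_norm_powr_cball:
  fixes \<gamma> r :: real
  assumes \<gamma>: "\<gamma> > - real DIM('a)" and r: "r \<ge> 0"
  shows "(\<integral>\<^sup>+ (z::'a::euclidean_space). ennreal (of_bool (norm z \<le> r) * norm z powr \<gamma>) \<partial>lborel) =
     ennreal (real DIM('a) * unit_ball_vol (real DIM('a)) / (\<gamma> + real DIM('a)) *
       r powr (\<gamma> + real DIM('a)))"
proof -
  define d where "d = DIM('a)"
  have d: "d \<ge> 1" by (simp add: d_def Suc_leI)
  define c where "c = real d * unit_ball_vol (real d)"
  have "(\<integral>\<^sup>+ (z::'a). ennreal (of_bool (norm z \<le> r) * norm z powr \<gamma>) \<partial>lborel) =
      (\<integral>\<^sup>+ t. ennreal (of_bool (t \<le> r) * t powr \<gamma>) \<partial>distr lborel borel (norm :: 'a \<Rightarrow> real))"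
    by (subst nn_integral_distr) auto
  also have "\<dots> = (\<integral>\<^sup>+ t. ennreal (indicator {0..} t * (c * t ^ (d - 1))) *
      ennreal (of_bool (t \<le> r) * t powr \<gamma>) \<partial>lborel)"
    unfolding distr_norm_lborel c_def d_def
    by (subst nn_integral_density) auto
  also have "\<dots> = (\<integral>\<^sup>+ t. ennreal (indicator {0..r} t * (c * t powr (\<gamma> + real d - 1))) \<partial>lborel)"
  proof (intro nn_integral_cong)
    fix t :: real
    \<comment> \<open>At \<open>t = 0\<close> both integrands below vanish because \<open>0 powr a = 0\<close>.\<close>
    have "t powr (\<gamma> + real d - 1) = t ^ (d - 1) * t powr \<gamma>" if "t > 0"
    proof -
      have "t powr (\<gamma> + real d - 1) = t powr (real (d - 1) + \<gamma>)"
        using d by (intro arg_cong[where f = "(powr) t"]) (simp add: of_nat_diff)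
      then show ?thesis using that by (simp add: powr_add powr_realpow)
    qed
    then show "ennreal (indicator {0..} t * (c * t ^ (d - 1))) *
        ennreal (of_bool (t \<le> r) * t powr \<gamma>) =
        ennreal (indicator {0..r} t * (c * t powr (\<gamma> + real d - 1)))"
      by (cases "t > 0") (auto simp: indicator_def c_def simp flip: ennreal_mult'')
  qed
  also have "\<dots> = ennreal (c * (r powr (\<gamma> + real d) / (\<gamma> + real d)))"
  proof (rule nn_integral_has_integral_lborel)
    have "((\<lambda>t. t powr (\<gamma> + real d - 1)) has_integral r powr (\<gamma> + real d) / (\<gamma> + real d)) {0..r}"
      using has_integral_powr_from_0[of "\<gamma> + real d - 1" r] \<gamma> r d_def by simp
    then have "((\<lambda>t. c * t powr (\<gamma> + real d - 1)) has_integral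
        c * (r powr (\<gamma> + real d) / (\<gamma> + real d))) {0..r}"
      by (rule has_integral_mult_right)
    then show "((\<lambda>t. indicator {0..r} t * (c * t powr (\<gamma> + real d - 1))) has_integral
        c * (r powr (\<gamma> + real d) / (\<gamma> + real d))) UNIV"
      by (rule has_integral_indicator_mult_UNIV)
  qed (auto simp: c_def indicator_def)
  finally show ?thesis by (simp add: c_def d_def)
qed

lemma nn_integral_lborel_shift:
  fixes c :: "'a::euclidean_space"
  assumes [measurable]: "u \<in> borel_measurable borel"
  shows "(\<integral>\<^sup>+ x. u (x + c) \<partial>lborel) = (\<integral>\<^sup>+ x. u x \<partial>lborel)"
proof -
  have "(\<integral>\<^sup>+ x. u x \<partial>lborel) = (\<integral>\<^sup>+ x. u x \<partial>distr lborel borel ((+) c))"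
    by (simp add: lborel_distr_plus)
  also have "\<dots> = (\<integral>\<^sup>+ x. u (x + c) \<partial>lborel)"
    by (subst nn_integral_distr) (auto simp: add.commute)
  finally show ?thesis by simp
qed

section \<open>Continuity of translations in the mean\<close>

lemma compact_open_approx_lborel:
  fixes A :: "'a::euclidean_space set" and \<epsilon> :: real
  assumes A[measurable]: "A \<in> sets borel" and fin: "emeasure lborel A < \<infinity>" and \<epsilon>: "\<epsilon> > 0"
  obtains K U where "compact K" "open U" "K \<subseteq> A" "A \<subseteq> U" "emeasure lborel (U - K) \<le> ennreal \<epsilon>"
proof -
  obtain U where U: "open U" "A \<subseteq> U" "emeasure lborel (U - A) \<le> ennreal (\<epsilon> / 2)"
    using outer_regular_lborel_le[OF A, of "\<epsilon> / 2"] \<epsilon> by auto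
  \<comment> \<open>Inner regularity requires a finite measure, hence the restriction to \<open>A\<close>.\<close>
  let ?M = "density lborel (indicator A)"
  have M: "emeasure ?M B = emeasure lborel (A \<inter> B)" if [measurable]: "B \<in> sets borel" for B
    by (subst emeasure_density) (auto simp: indicator_inter_arith simp flip: nn_integral_indicator)
  have "emeasure ?M A = (SUP K \<in> {K. K \<subseteq> A \<and> compact K}. emeasure ?M K)"
    using fin by (intro inner_regular) (auto simp: M)
  then have sup: "emeasure lborel A = (SUP K \<in> {K. K \<subseteq> A \<and> compact K}. emeasure ?M K)"
    by (simp add: M)
  have "\<exists>K\<in>{K. K \<subseteq> A \<and> compact K}. emeasure lborel A < emeasure ?M K + ennreal (\<epsilon> / 2)"
  proof (rule SUP_approx_ennreal[OF _ _ sup])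
    show "{K. K \<subseteq> A \<and> compact K} \<noteq> {}" using compact_empty by blast
  qed (use fin \<epsilon> in auto)
  then obtain K where K: "K \<subseteq> A" "compact K" "emeasure lborel A < emeasure ?M K + ennreal (\<epsilon> / 2)"
    by blast
  have [measurable]: "K \<in> sets borel" "U \<in> sets borel" using K U by (auto intro: borel_compact)
  have AK: "A \<inter> K = K" using K by auto
  have finK: "emeasure lborel K < \<infinity>"
    using emeasure_mono[of K A lborel] K fin by (auto intro: le_less_trans)
  have "emeasure lborel (A - K) = emeasure lborel A - emeasure lborel K"
    using K finK by (intro emeasure_Diff) auto
  also have "\<dots> \<le> ennreal (\<epsilon> / 2)"
    using K(3) fin by (auto simp: M AK ennreal_minus_le_iff less_imp_le)
  finally have "emeasure lborel (A - K) \<le> ennreal (\<epsilon> / 2)" .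
  moreover have "U - K = (U - A) \<union> (A - K)" using K U by auto
  then have "emeasure lborel (U - K) \<le> emeasure lborel (U - A) + emeasure lborel (A - K)"
    using emeasure_subadditive[of "U - A" lborel "A - K"] by simp
  ultimately have "emeasure lborel (U - K) \<le> ennreal (\<epsilon> / 2) + ennreal (\<epsilon> / 2)"
    using U(3) by (meson add_mono order_trans)
  also have "\<dots> = ennreal \<epsilon>" using \<epsilon> by (simp flip: ennreal_plus)
  finally show ?thesis using that K U by blast
qed

text \<open>The class of functions with this property is closed under sums and under dominated limits, the
latter because a translation does not change an integral.  It contains the indicator
of a set \<open>A\<close> of finite measure: if \<open>K \<subseteq> A \<subseteq> U\<close> with \<open>K\<close> compact and \<open>U\<close> open, a sufficiently
short translation moves \<open>K\<close> inside \<open>U\<close>, so that \<open>A\<close> and its translate can only differ on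
\<open>U - K\<close> and on the translate of \<open>U - K\<close>.\<close>

lemma L1_translation_continuous:
  fixes u :: "'a::euclidean_space \<Rightarrow> real"
  assumes "integrable lborel u" and "\<epsilon> > 0"
  shows "\<exists>\<delta>>0. \<forall>z. norm z < \<delta> \<longrightarrow> (\<integral>\<^sup>+ x. ennreal \<bar>u (x + z) - u x\<bar> \<partial>lborel) \<le> ennreal \<epsilon>"
  using assms
proof (induction arbitrary: \<epsilon> rule: integrable_induct)
  case (base A c)
  have [measurable]: "A \<in> sets borel" using base by simp
  define \<eta> where "\<eta> = \<epsilon> / (2 * (\<bar>c\<bar> + 1))"
  have \<eta>: "\<eta> > 0" using base by (simp add: \<eta>_def)
  obtain K U where KU: "compact K" "open U" "K \<subseteq> A" "A \<subseteq> U" "emeasure lborel (U - K) \<le> ennreal \<eta>"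
    using compact_open_approx_lborel[of A \<eta>] base \<eta> by auto
  have [measurable]: "K \<in> sets borel" "U \<in> sets borel" using KU by (auto intro: borel_compact)
  obtain \<delta> where \<delta>: "\<delta> > 0" "(\<Union>x\<in>K. ball x \<delta>) \<subseteq> U"
    using compact_subset_open_imp_ball_epsilon_subset[of K U] KU by auto
  have near: "y \<in> U" if "x \<in> K" "norm (y - x) < \<delta>" for x y
    using that \<delta>(2) by (auto simp: ball_def dist_norm norm_minus_commute)
  show ?case
  proof (intro exI[of _ \<delta>] conjI allI impI \<delta>(1))
    fix z :: 'a assume z: "norm z < \<delta>"
    have "\<bar>indicator A (x + z) *\<^sub>R c - indicator A x *\<^sub>R c\<bar> \<le>
        \<bar>c\<bar> * (indicator (U - K) (x + z) + indicator (U - K) x)" for x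
    proof -
      have "x \<in> K \<Longrightarrow> x + z \<in> U" "x + z \<in> K \<Longrightarrow> x \<in> U"
        using near[of x "x + z"] near[of "x + z" x] z by (auto simp: norm_minus_commute)
      then show ?thesis
        using KU(3,4) by (cases "x \<in> A"; cases "x + z \<in> A") (auto simp: indicator_def)
    qed
    then have "(\<integral>\<^sup>+ x. ennreal \<bar>indicator A (x + z) *\<^sub>R c - indicator A x *\<^sub>R c\<bar> \<partial>lborel)
        \<le> (\<integral>\<^sup>+ x. ennreal (\<bar>c\<bar> * (indicator (U - K) (x + z) + indicator (U - K) x)) \<partial>lborel)"
      by (intro nn_integral_mono ennreal_leI)
    also have "\<dots> = (\<integral>\<^sup>+ x. ennreal \<bar>c\<bar> * (indicator (U - K) (x + z) + indicator (U - K) x) \<partial>lborel)"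
      by (intro nn_integral_cong) (auto simp: indicator_def ennreal_mult'')
    also have "\<dots> = ennreal \<bar>c\<bar> * ((\<integral>\<^sup>+ x. indicator (U - K) (x + z) \<partial>lborel) + emeasure lborel (U - K))"
      by (subst nn_integral_cmult) (auto simp: nn_integral_add)
    also have "(\<integral>\<^sup>+ x. indicator (U - K) (x + z) \<partial>lborel) = emeasure lborel (U - K)"
      by (subst nn_integral_lborel_shift[of "indicator (U - K)"]) auto
    also have "ennreal \<bar>c\<bar> * (emeasure lborel (U - K) + emeasure lborel (U - K)) \<le>
        ennreal \<bar>c\<bar> * (ennreal \<eta> + ennreal \<eta>)"
      by (intro mult_left_mono add_mono KU) auto
    also have "\<dots> = ennreal (\<bar>c\<bar> * (2 * \<eta>))"
      using \<eta> by (simp add: ennreal_mult'' flip: ennreal_plus)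
    also have "\<dots> \<le> ennreal \<epsilon>"
    proof (rule ennreal_leI)
      show "\<bar>c\<bar> * (2 * \<eta>) \<le> \<epsilon>"
        using base by (simp add: \<eta>_def field_simps)
    qed
    finally show "(\<integral>\<^sup>+ x. ennreal \<bar>indicator A (x + z) *\<^sub>R c - indicator A x *\<^sub>R c\<bar> \<partial>lborel) \<le> ennreal \<epsilon>" .
  qed
next
  case (add u v)
  have [measurable]: "u \<in> borel_measurable borel" "v \<in> borel_measurable borel"
    using add by auto
  obtain \<delta> where \<delta>: "\<delta> > 0" "\<And>z. norm z < \<delta> \<Longrightarrow>
      (\<integral>\<^sup>+ x. ennreal \<bar>u (x + z) - u x\<bar> \<partial>lborel) \<le> ennreal (\<epsilon> / 2)"
    using add.IH(1)[of "\<epsilon> / 2"] add.prems by auto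
  obtain \<delta>' where \<delta>': "\<delta>' > 0" "\<And>z. norm z < \<delta>' \<Longrightarrow>
      (\<integral>\<^sup>+ x. ennreal \<bar>v (x + z) - v x\<bar> \<partial>lborel) \<le> ennreal (\<epsilon> / 2)"
    using add.IH(2)[of "\<epsilon> / 2"] add.prems by auto
  show ?case
  proof (intro exI[of _ "min \<delta> \<delta>'"] conjI allI impI)
    fix z :: 'a assume z: "norm z < min \<delta> \<delta>'"
    have "(\<integral>\<^sup>+ x. ennreal \<bar>(u (x + z) + v (x + z)) - (u x + v x)\<bar> \<partial>lborel) \<le>
        (\<integral>\<^sup>+ x. ennreal \<bar>u (x + z) - u x\<bar> + ennreal \<bar>v (x + z) - v x\<bar> \<partial>lborel)"
      by (intro nn_integral_mono) (auto simp flip: ennreal_plus intro!: ennreal_leI)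
    also have "\<dots> = (\<integral>\<^sup>+ x. ennreal \<bar>u (x + z) - u x\<bar> \<partial>lborel) +
        (\<integral>\<^sup>+ x. ennreal \<bar>v (x + z) - v x\<bar> \<partial>lborel)"
      by (intro nn_integral_add) auto
    also have "\<dots> \<le> ennreal (\<epsilon> / 2) + ennreal (\<epsilon> / 2)"
      using z by (intro add_mono \<delta> \<delta>') auto
    also have "\<dots> = ennreal \<epsilon>" using add.prems by (simp flip: ennreal_plus)
    finally show "(\<integral>\<^sup>+ x. ennreal \<bar>(u (x + z) + v (x + z)) - (u x + v x)\<bar> \<partial>lborel) \<le> ennreal \<epsilon>" .
  qed (use \<delta> \<delta>' in auto)
next
  case (lim u s)
  have [measurable]: "u \<in> borel_measurable borel" "s i \<in> borel_measurable borel" for i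
    using lim.hyps(1)[of i] lim.hyps(4) by auto
  have conv: "(\<lambda>i. \<integral>\<^sup>+ x. norm (u x - s i x) \<partial>lborel) \<longlonglongrightarrow> 0"
  proof (rule nn_integral_dominated_convergence_norm[where w = "\<lambda>x. 2 * norm (u x)"])
    show "(\<integral>\<^sup>+ x. ennreal (2 * norm (u x)) \<partial>lborel) < \<infinity>"
      using lim.hyps(4) by (auto simp: integrable_iff_bounded ennreal_mult' nn_integral_cmult ennreal_mult_less_top)
  qed (use lim.hyps(2,3) in auto)
  have "eventually (\<lambda>i. (\<integral>\<^sup>+ x. norm (u x - s i x) \<partial>lborel) < ennreal (\<epsilon> / 3)) sequentially"
    using lim.prems by (intro order_tendstoD[OF conv]) auto
  then obtain i where i: "(\<integral>\<^sup>+ x. norm (u x - s i x) \<partial>lborel) < ennreal (\<epsilon> / 3)"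
    using eventually_happens by fastforce
  obtain \<delta> where \<delta>: "\<delta> > 0" "\<And>z. norm z < \<delta> \<Longrightarrow>
      (\<integral>\<^sup>+ x. ennreal \<bar>s i (x + z) - s i x\<bar> \<partial>lborel) \<le> ennreal (\<epsilon> / 3)"
    using lim.IH[of "\<epsilon> / 3" i] lim.prems by auto
  show ?case
  proof (intro exI[of _ \<delta>] conjI allI impI \<delta>(1))
    fix z :: 'a assume z: "norm z < \<delta>"
    have "(\<integral>\<^sup>+ x. ennreal \<bar>u (x + z) - u x\<bar> \<partial>lborel) \<le>
        (\<integral>\<^sup>+ x. ennreal \<bar>s i (x + z) - s i x\<bar> +
          (ennreal (norm (u (x + z) - s i (x + z))) + ennreal (norm (u x - s i x))) \<partial>lborel)"
      by (intro nn_integral_mono) (auto simp flip: ennreal_plus intro!: ennreal_leI)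
    also have "\<dots> = (\<integral>\<^sup>+ x. ennreal \<bar>s i (x + z) - s i x\<bar> \<partial>lborel) +
          ((\<integral>\<^sup>+ x. ennreal (norm (u (x + z) - s i (x + z))) \<partial>lborel) +
           (\<integral>\<^sup>+ x. ennreal (norm (u x - s i x)) \<partial>lborel))"
      by (simp add: nn_integral_add)
    also have "(\<integral>\<^sup>+ x. ennreal (norm (u (x + z) - s i (x + z))) \<partial>lborel) =
        (\<integral>\<^sup>+ x. ennreal (norm (u x - s i x)) \<partial>lborel)"
      by (rule nn_integral_lborel_shift) auto
    also have "(\<integral>\<^sup>+ x. ennreal \<bar>s i (x + z) - s i x\<bar> \<partial>lborel) +
        ((\<integral>\<^sup>+ x. ennreal (norm (u x - s i x)) \<partial>lborel) +
         (\<integral>\<^sup>+ x. ennreal (norm (u x - s i x)) \<partial>lborel)) \<le>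
        ennreal (\<epsilon> / 3) + (ennreal (\<epsilon> / 3) + ennreal (\<epsilon> / 3))"
      using z i by (intro add_mono \<delta>) auto
    also have "\<dots> = ennreal \<epsilon>" using lim.prems by (simp flip: ennreal_plus)
    finally show "(\<integral>\<^sup>+ x. ennreal \<bar>u (x + z) - u x\<bar> \<partial>lborel) \<le> ennreal \<epsilon>" .
  qed
qed

section \<open>Square integrals and autocorrelations of densities\<close>

text \<open>The equality case of the Cauchy-Schwarz inequality on \<open>W\<close>, a set of measure one: since \<open>f\<close>
vanishes outside \<open>W\<close>, one has \<open>\<integral>(f - 1\<^sub>W)\<^sup>2 = \<integral>f\<^sup>2 - 1\<close>, which is positive unless \<open>f = 1\<^sub>W\<close>
almost everywhere.  The identity is used with all negative terms moved to the other side, so that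
\<open>\<integral>f\<^sup>2 = \<infinity>\<close> needs no separate treatment.\<close>

lemma density_square_integral_gt_1:
  fixes f :: "'a::euclidean_space \<Rightarrow> real"
  assumes W_meas: "W \<in> sets lebesgue"
    and W_vol: "emeasure lebesgue W = 1"
    and f_meas: "f \<in> borel_measurable borel"
    and f_nonneg: "\<And>x. 0 \<le> f x"
    and f_int: "(\<integral>\<^sup>+ x. ennreal (f x) \<partial>lborel) = 1"
    and f_supp: "{x. f x \<noteq> 0} \<subseteq> W"
    and f_neq: "\<not> (AE x in lebesgue. x \<in> W \<longrightarrow> f x = indicator W x)"
  shows "1 < (\<integral>\<^sup>+ x. ennreal ((f x)\<^sup>2) \<partial>lborel)"
proof (rule ccontr)
  assume "\<not> ?thesis"
  then have le: "(\<integral>\<^sup>+ x. ennreal ((f x)\<^sup>2) \<partial>lebesgue) \<le> 1"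
    by (simp add: nn_integral_completion)
  note [measurable] = W_meas
  have [measurable]: "f \<in> borel_measurable lebesgue"
    using f_meas by (intro measurable_completion) simp
  have "(\<integral>\<^sup>+ x. ennreal ((f x - indicator W x)\<^sup>2) \<partial>lebesgue) + 2 =
      (\<integral>\<^sup>+ x. ennreal ((f x - indicator W x)\<^sup>2) \<partial>lebesgue) + 2 * (\<integral>\<^sup>+ x. ennreal (f x) \<partial>lebesgue)"
    by (simp add: nn_integral_completion f_int)
  also have "\<dots> = (\<integral>\<^sup>+ x. ennreal ((f x - indicator W x)\<^sup>2) + 2 * ennreal (f x) \<partial>lebesgue)"
    by (simp add: nn_integral_add nn_integral_cmult)
  also have "\<dots> = (\<integral>\<^sup>+ x. ennreal ((f x)\<^sup>2) + indicator W x \<partial>lebesgue)"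
  proof (intro nn_integral_cong)
    fix x
    have "(f x - indicator W x)\<^sup>2 + 2 * f x = (f x)\<^sup>2 + indicator W x"
      using f_supp by (cases "x \<in> W") (auto simp: power2_eq_square algebra_simps)
    then have "ennreal ((f x - indicator W x)\<^sup>2 + 2 * f x) = ennreal ((f x)\<^sup>2 + indicator W x)"
      by simp
    then show "ennreal ((f x - indicator W x)\<^sup>2) + 2 * ennreal (f x) =
        ennreal ((f x)\<^sup>2) + indicator W x"
      using f_nonneg[of x] by (simp add: ennreal_mult ennreal_indicator)
  qed
  also have "\<dots> = (\<integral>\<^sup>+ x. ennreal ((f x)\<^sup>2) \<partial>lebesgue) + 1"
    by (simp add: nn_integral_add W_vol)
  also have "\<dots> \<le> 0 + 2" using add_right_mono[OF le, of 1] by simp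
  finally have "(\<integral>\<^sup>+ x. ennreal ((f x - indicator W x)\<^sup>2) \<partial>lebesgue) + 2 \<le> 0 + 2" .
  then have "(\<integral>\<^sup>+ x. ennreal ((f x - indicator W x)\<^sup>2) \<partial>lebesgue) = 0"
    by (subst (asm) ennreal_add_left_cancel_le[of 2, unfolded add.commute[of 2]]) auto
  then have "AE x in lebesgue. ennreal ((f x - indicator W x)\<^sup>2) = 0"
    by (subst (asm) nn_integral_0_iff_AE) auto
  then have "AE x in lebesgue. x \<in> W \<longrightarrow> f x = indicator W x"
    by eventually_elim auto
  then show False using f_neq by simp
qed

text \<open>The density may fail to be square integrable, and the edge functional may then have infinite
variance.  Discarding the points where \<open>f\<close> exceeds a high level \<open>m\<close> makes all moments finite
and, by monotone convergence, keeps the integral of the square above \<open>c\<close>.\<close>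

lemma truncated_square_integral:
  fixes f :: "'a \<Rightarrow> real"
  assumes [measurable]: "f \<in> borel_measurable M" and gt: "c < (\<integral>\<^sup>+ x. ennreal ((f x)\<^sup>2) \<partial>M)"
  shows "\<exists>m>0. c < (\<integral>\<^sup>+ x. ennreal ((of_bool (f x \<le> m) * f x)\<^sup>2) \<partial>M)"
proof -
  let ?u = "\<lambda>n x. ennreal ((of_bool (f x \<le> real (Suc n)) * f x)\<^sup>2)"
  have sup: "(SUP n. ?u n x) = ennreal ((f x)\<^sup>2)" for x
  proof (rule antisym)
    show "(SUP n. ?u n x) \<le> ennreal ((f x)\<^sup>2)"
      by (intro SUP_least ennreal_leI) (auto simp: of_bool_def)
    obtain n where "f x \<le> real n" using real_arch_simple by blast
    then have "ennreal ((f x)\<^sup>2) = ?u n x" by (auto simp: of_bool_def)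
    also have "\<dots> \<le> (SUP n. ?u n x)" by (rule SUP_upper) simp
    finally show "ennreal ((f x)\<^sup>2) \<le> (SUP n. ?u n x)" .
  qed
  have "incseq ?u"
    by (intro incseq_SucI le_funI ennreal_leI) (auto simp: of_bool_def)
  then have "(\<integral>\<^sup>+ x. (SUP n. ?u n x) \<partial>M) = (SUP n. \<integral>\<^sup>+ x. ?u n x \<partial>M)"
    by (intro nn_integral_monotone_convergence_SUP) auto
  then have "c < (SUP n. \<integral>\<^sup>+ x. ?u n x \<partial>M)" using gt by (simp only: sup)
  then obtain n where "c < (\<integral>\<^sup>+ x. ?u n x \<partial>M)" by (auto simp: less_SUP_iff)
  then show ?thesis by (intro exI[of _ "real (Suc n)"]) auto
qed

text \<open>The autocorrelation of \<open>g\<close> at \<open>0\<close> is \<open>\<integral>g\<^sup>2\<close>, and moving its argument to \<open>z\<close> costs at most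
\<open>m \<integral>\<bar>g(x + z) - g(x)\<bar> dx\<close>.\<close>

lemma autocorrelation_lower_bound:
  fixes g :: "'a::euclidean_space \<Rightarrow> real"
  assumes g: "integrable lborel g" and g0: "\<And>x. 0 \<le> g x" and gm: "\<And>x. g x \<le> m"
    and m: "m > 0" and s: "s \<ge> 0" and gt: "ennreal s < (\<integral>\<^sup>+ x. ennreal ((g x)\<^sup>2) \<partial>lborel)"
  shows "\<exists>\<delta>>0. \<forall>z. norm z < \<delta> \<longrightarrow> ennreal s \<le> (\<integral>\<^sup>+ x. ennreal (g x * g (x + z)) \<partial>lborel)"
proof -
  have [measurable]: "g \<in> borel_measurable borel" using g by auto
  have "(\<integral>\<^sup>+ x. ennreal ((g x)\<^sup>2) \<partial>lborel) \<le> (\<integral>\<^sup>+ x. ennreal m * ennreal (g x) \<partial>lborel)"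
    using g0 gm m by (intro nn_integral_mono)
      (auto simp: power2_eq_square simp flip: ennreal_mult'' intro!: ennreal_leI mult_right_mono)
  also have "\<dots> = ennreal m * (\<integral>\<^sup>+ x. ennreal (g x) \<partial>lborel)"
    by (simp add: nn_integral_cmult)
  also have "\<dots> < \<infinity>"
    using g g0 by (auto simp: nn_integral_eq_integral ennreal_mult_less_top)
  finally obtain q where q: "q \<ge> 0" "(\<integral>\<^sup>+ x. ennreal ((g x)\<^sup>2) \<partial>lborel) = ennreal q"
    by (cases "\<integral>\<^sup>+ x. ennreal ((g x)\<^sup>2) \<partial>lborel" rule: ennreal_cases) auto
  have sq: "s < q" using gt q s by (simp add: ennreal_less_iff)
  obtain \<delta> where \<delta>: "\<delta> > 0" "\<And>z. norm z < \<delta> \<Longrightarrow>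
      (\<integral>\<^sup>+ x. ennreal \<bar>g (x + z) - g x\<bar> \<partial>lborel) \<le> ennreal ((q - s) / m)"
    using L1_translation_continuous[OF g, of "(q - s) / m"] sq m by auto
  show ?thesis
  proof (intro exI[of _ \<delta>] conjI allI impI \<delta>(1))
    fix z :: 'a assume z: "norm z < \<delta>"
    let ?G = "\<integral>\<^sup>+ x. ennreal (g x * g (x + z)) \<partial>lborel"
    have "ennreal q \<le> (\<integral>\<^sup>+ x. ennreal (g x * g (x + z)) + ennreal m * ennreal \<bar>g (x + z) - g x\<bar> \<partial>lborel)"
      unfolding q(2)[symmetric]
    proof (intro nn_integral_mono)
      fix x
      have "g x * (g x - g (x + z)) \<le> m * \<bar>g (x + z) - g x\<bar>"
        using g0[of x] gm[of x]
        by (intro order_trans[OF mult_left_mono[OF abs_ge_self] mult_mono[OF gm]])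
           (auto simp: abs_minus_commute)
      then have "(g x)\<^sup>2 \<le> g x * g (x + z) + m * \<bar>g (x + z) - g x\<bar>"
        by (simp add: power2_eq_square algebra_simps)
      then show "ennreal ((g x)\<^sup>2) \<le> ennreal (g x * g (x + z)) + ennreal m * ennreal \<bar>g (x + z) - g x\<bar>"
        using g0 m by (simp flip: ennreal_plus ennreal_mult'' add: ennreal_leI)
    qed
    also have "\<dots> = ?G + ennreal m * (\<integral>\<^sup>+ x. ennreal \<bar>g (x + z) - g x\<bar> \<partial>lborel)"
      by (simp add: nn_integral_add nn_integral_cmult)
    also have "\<dots> \<le> ?G + ennreal m * ennreal ((q - s) / m)"
      by (intro add_left_mono mult_left_mono \<delta> z) auto
    also have "ennreal m * ennreal ((q - s) / m) = ennreal (q - s)"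
      using m sq by (simp flip: ennreal_mult)
    finally have "ennreal s + ennreal (q - s) \<le> ?G + ennreal (q - s)"
      using s sq by (simp flip: ennreal_plus)
    then show "ennreal s \<le> ?G"
      by (simp add: add.commute[of _ "ennreal (q - s)"] ennreal_add_left_cancel_le)
  qed
qed

text \<open>After the substitution \<open>y = x + z\<close> and an exchange of the integrals, the double integral is the
integral of the autocorrelation of \<open>g\<close> against \<open>k\<close>.\<close>

lemma convolution_pairing_lower_bound:
  fixes g k :: "'a::euclidean_space \<Rightarrow> real"
  assumes [measurable]: "g \<in> borel_measurable borel" "k \<in> borel_measurable borel"
    and g0: "\<And>x. 0 \<le> g x" and k0: "\<And>z. 0 \<le> k z"
    and corr: "\<And>z. k z \<noteq> 0 \<Longrightarrow> ennreal s \<le> (\<integral>\<^sup>+ x. ennreal (g x * g (x + z)) \<partial>lborel)"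
  shows "ennreal s * (\<integral>\<^sup>+ z. ennreal (k z) \<partial>lborel) \<le>
    (\<integral>\<^sup>+ x. \<integral>\<^sup>+ y. ennreal (g x * g y * k (y - x)) \<partial>lborel \<partial>lborel)"
proof -
  have "(\<integral>\<^sup>+ x. \<integral>\<^sup>+ y. ennreal (g x * g y * k (y - x)) \<partial>lborel \<partial>lborel) =
      (\<integral>\<^sup>+ x. \<integral>\<^sup>+ z. ennreal (k z) * ennreal (g x * g (x + z)) \<partial>lborel \<partial>lborel)"
  proof (rule nn_integral_cong)
    fix x :: 'a
    have "(\<integral>\<^sup>+ y. ennreal (g x * g y * k (y - x)) \<partial>lborel) =
        (\<integral>\<^sup>+ z. ennreal (g x * g (z + x) * k (z + x - x)) \<partial>lborel)"
      by (rule nn_integral_lborel_shift[symmetric]) measurable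
    also have "\<dots> = (\<integral>\<^sup>+ z. ennreal (k z) * ennreal (g x * g (x + z)) \<partial>lborel)"
      using g0 k0 by (intro nn_integral_cong) (simp add: ac_simps flip: ennreal_mult)
    finally show "(\<integral>\<^sup>+ y. ennreal (g x * g y * k (y - x)) \<partial>lborel) =
        (\<integral>\<^sup>+ z. ennreal (k z) * ennreal (g x * g (x + z)) \<partial>lborel)" .
  qed
  also have "\<dots> = (\<integral>\<^sup>+ z. \<integral>\<^sup>+ x. ennreal (k z) * ennreal (g x * g (x + z)) \<partial>lborel \<partial>lborel)"
    by (rule lborel_pair.Fubini') measurable
  also have "\<dots> = (\<integral>\<^sup>+ z. ennreal (k z) * (\<integral>\<^sup>+ x. ennreal (g x * g (x + z)) \<partial>lborel) \<partial>lborel)"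
    by (intro nn_integral_cong nn_integral_cmult) measurable
  also have "\<dots> \<ge> (\<integral>\<^sup>+ z. ennreal (k z) * ennreal s \<partial>lborel)"
  proof (intro nn_integral_mono)
    fix z :: 'a
    show "ennreal (k z) * ennreal s \<le> ennreal (k z) * (\<integral>\<^sup>+ x. ennreal (g x * g (x + z)) \<partial>lborel)"
      using corr[of z] by (cases "k z = 0") (auto intro: mult_left_mono)
  qed
  moreover have "(\<integral>\<^sup>+ z. ennreal (k z) * ennreal s \<partial>lborel) = ennreal s * (\<integral>\<^sup>+ z. ennreal (k z) \<partial>lborel)"
    by (subst nn_integral_multc) (auto simp: mult.commute)
  ultimately show ?thesis by simp
qed

section \<open>Sums of a symmetric kernel over pairs of independent variables\<close>

context prob_space
begin

lemma nn_integral_indep_pair: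
  assumes indep: "indep_var S U T V" and \<phi>: "\<phi> \<in> borel_measurable (S \<Otimes>\<^sub>M T)"
  shows "(\<integral>\<^sup>+ \<omega>. \<phi> (U \<omega>, V \<omega>) \<partial>M) = (\<integral>\<^sup>+ \<omega>. \<integral>\<^sup>+ \<omega>'. \<phi> (U \<omega>, V \<omega>') \<partial>M \<partial>M)"
proof -
  note [measurable] = \<phi>
  have [measurable]: "U \<in> measurable M S" "V \<in> measurable M T"
    and joint: "distr M S U \<Otimes>\<^sub>M distr M T V = distr M (S \<Otimes>\<^sub>M T) (\<lambda>\<omega>. (U \<omega>, V \<omega>))"
    using indep unfolding indep_var_distribution_eq by blast+
  interpret V: prob_space "distr M T V" by (rule prob_space_distr) simp
  have "(\<integral>\<^sup>+ \<omega>. \<phi> (U \<omega>, V \<omega>) \<partial>M) = (\<integral>\<^sup>+ z. \<phi> z \<partial>(distr M S U \<Otimes>\<^sub>M distr M T V))"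
    by (simp add: joint nn_integral_distr)
  also have "\<dots> = (\<integral>\<^sup>+ x. \<integral>\<^sup>+ y. \<phi> (x, y) \<partial>distr M T V \<partial>distr M S U)"
    by (subst V.nn_integral_fst[symmetric]) auto
  also have "\<dots> = (\<integral>\<^sup>+ x. \<integral>\<^sup>+ \<omega>'. \<phi> (x, V \<omega>') \<partial>M \<partial>distr M S U)"
    by (intro nn_integral_cong nn_integral_distr) (auto simp: space_distr)
  also have "\<dots> = (\<integral>\<^sup>+ \<omega>. \<integral>\<^sup>+ \<omega>'. \<phi> (U \<omega>, V \<omega>') \<partial>M \<partial>M)"
    by (rule nn_integral_distr) auto
  finally show ?thesis .
qed

lemma indep_vars_imp_indep_var_pair:
  assumes "indep_vars (\<lambda>_. N) X I" "i \<in> I" "j \<in> I" "i \<noteq> j"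
  shows "indep_var N (X i) N (X j)"
proof -
  have "indep_var N ((\<lambda>g. g i) \<circ> (\<lambda>\<omega>. restrict (\<lambda>k. X k \<omega>) {i})) N ((\<lambda>g. g j) \<circ> (\<lambda>\<omega>. restrict (\<lambda>k. X k \<omega>) {j}))"
    using assms by (intro indep_var_compose[OF indep_var_restrict[OF assms(1)]]) auto
  then show ?thesis by (simp add: comp_def)
qed

text \<open>The indices \<open>i\<close> and \<open>j\<close> may coincide; this covers the independence of one variable from a pair,
encoded as the pair with two equal entries, so that both variables have the same type.\<close>

lemma indep_vars_imp_indep_var_pairs:
  assumes "indep_vars (\<lambda>_. N) X I" "{i, j, k, l} \<subseteq> I" "{i, j} \<inter> {k, l} = {}"
  shows "indep_var (N \<Otimes>\<^sub>M N) (\<lambda>\<omega>. (X i \<omega>, X j \<omega>)) (N \<Otimes>\<^sub>M N) (\<lambda>\<omega>. (X k \<omega>, X l \<omega>))"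
proof -
  have "indep_var (N \<Otimes>\<^sub>M N) ((\<lambda>g. (g i, g j)) \<circ> (\<lambda>\<omega>. restrict (\<lambda>k. X k \<omega>) {i, j}))
      (N \<Otimes>\<^sub>M N) ((\<lambda>g. (g k, g l)) \<circ> (\<lambda>\<omega>. restrict (\<lambda>k. X k \<omega>) {k, l}))"
    using assms by (intro indep_var_compose[OF indep_var_restrict[OF assms(1)]]) auto
  then show ?thesis by (simp add: comp_def)
qed

end

definition offdiag :: "'i set \<Rightarrow> ('i \<times> 'i) set" where
  "offdiag I = {(i, j). i \<in> I \<and> j \<in> I \<and> i \<noteq> j}"

lemma finite_offdiag [simp]: "finite I \<Longrightarrow> finite (offdiag I)"
  by (rule finite_subset[of _ "I \<times> I"]) (auto simp: offdiag_def)

lemma card_offdiag: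
  assumes "finite I"
  shows "real (card (offdiag I)) = real (card I) * (real (card I) - 1)"
proof -
  have eq: "offdiag I = I \<times> I - (\<lambda>i. (i, i)) ` I" by (auto simp: offdiag_def)
  have sub: "(\<lambda>i. (i, i)) ` I \<subseteq> I \<times> I" by auto
  have "card ((\<lambda>i. (i, i)) ` I) = card I" by (rule card_image) (auto simp: inj_on_def)
  then have "card (offdiag I) = card I * card I - card I"
    using assms sub unfolding eq by (simp add: card_Diff_subset card_cartesian_product)
  then show ?thesis
    by (simp add: of_nat_diff algebra_simps)
qed

text \<open>A symmetric kernel \<open>h\<close> evaluated at all ordered pairs of distinct members of an independent
family.  The number \<open>\<mu>\<close> is the common mean of the summands, \<open>V\<close> bounds their second moment, and
\<open>b\<close> bounds the mean of \<open>h\<close> when one argument is held fixed.\<close>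

locale symmetric_kernel_sample = prob_space M for M :: "'w measure" +
  fixes N :: "'b measure" and X :: "'i \<Rightarrow> 'w \<Rightarrow> 'b" and I :: "'i set"
    and h :: "'b \<Rightarrow> 'b \<Rightarrow> real" and \<mu> V b :: real
  assumes fin: "finite I"
    and indep: "indep_vars (\<lambda>_. N) X I"
    and h_meas: "case_prod h \<in> borel_measurable (N \<Otimes>\<^sub>M N)"
    and h_nonneg: "\<And>x y. 0 \<le> h x y"
    and h_sym: "\<And>x y. h x y = h y x"
    and nonneg: "0 \<le> \<mu>" "0 \<le> V" "0 \<le> b"
    and mean: "\<And>i j. i \<in> I \<Longrightarrow> j \<in> I \<Longrightarrow> i \<noteq> j \<Longrightarrow>
      (\<integral>\<^sup>+ \<omega>. ennreal (h (X i \<omega>) (X j \<omega>)) \<partial>M) = ennreal \<mu>"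
    and second: "\<And>i j. i \<in> I \<Longrightarrow> j \<in> I \<Longrightarrow> i \<noteq> j \<Longrightarrow>
      (\<integral>\<^sup>+ \<omega>. ennreal ((h (X i \<omega>) (X j \<omega>))\<^sup>2) \<partial>M) \<le> ennreal V"
    and section_mean: "\<And>i x. i \<in> I \<Longrightarrow> x \<in> space N \<Longrightarrow>
      (\<integral>\<^sup>+ \<omega>. ennreal (h x (X i \<omega>)) \<partial>M) \<le> ennreal b"
begin

definition pair_sum :: "'w \<Rightarrow> real" where
  "pair_sum \<omega> = (\<Sum>(i, j) \<in> offdiag I. h (X i \<omega>) (X j \<omega>))"

lemma X_measurable [measurable]: "i \<in> I \<Longrightarrow> X i \<in> measurable M N"
  using indep unfolding indep_vars_def by blast

lemma X_offdiag_measurable [measurable]: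
  "p \<in> offdiag I \<Longrightarrow> X (fst p) \<in> measurable M N"
  "p \<in> offdiag I \<Longrightarrow> X (snd p) \<in> measurable M N"
  by (auto simp: offdiag_def)

lemma kernel_measurable [measurable]:
  assumes [measurable]: "f \<in> measurable K N" "g \<in> measurable K N"
  shows "(\<lambda>x. h (f x) (g x)) \<in> borel_measurable K"
  using measurable_compose[OF measurable_Pair[OF assms] h_meas] by (simp only: prod.case)

lemma product_moment_disjoint:
  assumes "{i, j, k, l} \<subseteq> I" "i \<noteq> j" "k \<noteq> l" "{i, j} \<inter> {k, l} = {}"
  shows "(\<integral>\<^sup>+ \<omega>. ennreal (h (X i \<omega>) (X j \<omega>) * h (X k \<omega>) (X l \<omega>)) \<partial>M) = ennreal (\<mu>\<^sup>2)"
proof -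
  let ?\<phi> = "\<lambda>p. ennreal (h (fst (fst p)) (snd (fst p))) * ennreal (h (fst (snd p)) (snd (snd p)))"
  have [measurable]: "X i \<in> measurable M N" "X j \<in> measurable M N"
      "X k \<in> measurable M N" "X l \<in> measurable M N"
    using assms by auto
  have "(\<integral>\<^sup>+ \<omega>. ennreal (h (X i \<omega>) (X j \<omega>) * h (X k \<omega>) (X l \<omega>)) \<partial>M) =
      (\<integral>\<^sup>+ \<omega>. ?\<phi> ((X i \<omega>, X j \<omega>), (X k \<omega>, X l \<omega>)) \<partial>M)"
    by (simp add: ennreal_mult h_nonneg)
  also have "\<dots> = (\<integral>\<^sup>+ \<omega>. \<integral>\<^sup>+ \<omega>'. ?\<phi> ((X i \<omega>, X j \<omega>), (X k \<omega>', X l \<omega>')) \<partial>M \<partial>M)"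
    using indep_vars_imp_indep_var_pairs[OF indep assms(1,4)]
    by (rule nn_integral_indep_pair) measurable
  also have "\<dots> = (\<integral>\<^sup>+ \<omega>. ennreal (h (X i \<omega>) (X j \<omega>)) \<partial>M) *
      (\<integral>\<^sup>+ \<omega>. ennreal (h (X k \<omega>) (X l \<omega>)) \<partial>M)"
    by (simp add: nn_integral_cmult nn_integral_multc)
  also have "\<dots> = ennreal (\<mu>\<^sup>2)"
    using assms nonneg by (simp add: mean power2_eq_square ennreal_mult)
  finally show ?thesis .
qed

text \<open>Conditionally on the shared variable \<open>X i\<close> the two factors are independent, each with mean at
most \<open>b\<close>.\<close>

lemma product_moment_shared:
  assumes "{i, j, k} \<subseteq> I" "i \<noteq> j" "i \<noteq> k" "j \<noteq> k"
  shows "(\<integral>\<^sup>+ \<omega>. ennreal (h (X i \<omega>) (X j \<omega>) * h (X i \<omega>) (X k \<omega>)) \<partial>M) \<le> ennreal (b\<^sup>2)"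
proof -
  let ?\<phi> = "\<lambda>p :: ('b \<times> 'b) \<times> ('b \<times> 'b). ennreal (h (fst (fst p)) (fst (snd p))) * ennreal (h (fst (fst p)) (snd (snd p)))"
  have [measurable]: "X i \<in> measurable M N" "X j \<in> measurable M N" "X k \<in> measurable M N"
    using assms by auto
  have "(\<integral>\<^sup>+ \<omega>. ennreal (h (X i \<omega>) (X j \<omega>) * h (X i \<omega>) (X k \<omega>)) \<partial>M) =
      (\<integral>\<^sup>+ \<omega>. ?\<phi> ((X i \<omega>, X i \<omega>), (X j \<omega>, X k \<omega>)) \<partial>M)"
    by (simp add: ennreal_mult h_nonneg)
  also have "\<dots> = (\<integral>\<^sup>+ \<omega>. \<integral>\<^sup>+ \<omega>'. ?\<phi> ((X i \<omega>, X i \<omega>), (X j \<omega>', X k \<omega>')) \<partial>M \<partial>M)"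
    using assms by (intro nn_integral_indep_pair[OF indep_vars_imp_indep_var_pairs[OF indep]]) auto
  also have "\<dots> \<le> (\<integral>\<^sup>+ \<omega>. ennreal (b\<^sup>2) \<partial>M)"
  proof (rule nn_integral_mono)
    fix \<omega> assume "\<omega> \<in> space M"
    define x where "x = X i \<omega>"
    have x [measurable]: "x \<in> space N"
      using \<open>\<omega> \<in> space M\<close> assms by (auto simp: x_def intro: measurable_space)
    let ?\<psi> = "\<lambda>q. ennreal (h x (fst q)) * ennreal (h x (snd q))"
    have "(\<integral>\<^sup>+ \<omega>'. ?\<phi> ((X i \<omega>, X i \<omega>), (X j \<omega>', X k \<omega>')) \<partial>M) = (\<integral>\<^sup>+ \<omega>'. ?\<psi> (X j \<omega>', X k \<omega>') \<partial>M)"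
      by (simp add: x_def)
    also have "\<dots> = (\<integral>\<^sup>+ \<omega>'. \<integral>\<^sup>+ \<omega>''. ?\<psi> (X j \<omega>', X k \<omega>'') \<partial>M \<partial>M)"
      using assms x by (intro nn_integral_indep_pair[OF indep_vars_imp_indep_var_pair[OF indep]]) auto
    also have "\<dots> = (\<integral>\<^sup>+ \<omega>'. ennreal (h x (X j \<omega>')) \<partial>M) * (\<integral>\<^sup>+ \<omega>'. ennreal (h x (X k \<omega>')) \<partial>M)"
      by (simp add: nn_integral_cmult nn_integral_multc)
    also have "\<dots> \<le> ennreal b * ennreal b"
      using assms x by (intro mult_mono section_mean) auto
    also have "\<dots> = ennreal (b\<^sup>2)"
      using nonneg by (simp add: power2_eq_square ennreal_mult)
    finally show "(\<integral>\<^sup>+ \<omega>'. ?\<phi> ((X i \<omega>, X i \<omega>), (X j \<omega>', X k \<omega>')) \<partial>M) \<le> ennreal (b\<^sup>2)" .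
  qed
  also have "\<dots> = ennreal (b\<^sup>2)" by (simp add: emeasure_space_1)
  finally show ?thesis .
qed

text \<open>Bound for the covariance of the summands with index pairs \<open>(i, j)\<close> and \<open>(k, l)\<close>: it is at
most \<open>V\<close> if the pairs agree as sets, at most \<open>b\<^sup>2\<close> if they share one index, and \<open>0\<close> if
they are disjoint.\<close>

definition overlap :: "'i \<times> 'i \<Rightarrow> 'i \<times> 'i \<Rightarrow> real" where
  "overlap = (\<lambda>(i, j) (k, l).
     (of_bool (i = k \<and> j = l) + of_bool (i = l \<and> j = k)) * V +
     (of_bool (i = k) + of_bool (i = l) + of_bool (j = k) + of_bool (j = l)) * b\<^sup>2)"

lemma overlap_nonneg: "0 \<le> overlap p q"
  unfolding overlap_def case_prod_unfold
  by (intro add_nonneg_nonneg mult_nonneg_nonneg) (auto intro: nonneg)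

lemma product_moment_le:
  assumes "(i, j) \<in> offdiag I" "(k, l) \<in> offdiag I"
  shows "(\<integral>\<^sup>+ \<omega>. ennreal (h (X i \<omega>) (X j \<omega>) * h (X k \<omega>) (X l \<omega>)) \<partial>M) \<le>
    ennreal (\<mu>\<^sup>2 + overlap (i, j) (k, l))"
proof -
  have I: "i \<in> I" "j \<in> I" "k \<in> I" "l \<in> I" "i \<noteq> j" "k \<noteq> l"
    using assms by (auto simp: offdiag_def)
  have b2: "0 \<le> b\<^sup>2" "0 \<le> \<mu>\<^sup>2" by auto
  let ?E = "\<integral>\<^sup>+ \<omega>. ennreal (h (X i \<omega>) (X j \<omega>) * h (X k \<omega>) (X l \<omega>)) \<partial>M"
  consider "i \<noteq> k" "i \<noteq> l" "j \<noteq> k" "j \<noteq> l" | "i = k \<and> j = l \<or> i = l \<and> j = k"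
    | "i = k" "j \<noteq> l" | "i = l" "j \<noteq> k" | "j = k" "i \<noteq> l" | "j = l" "i \<noteq> k"
    by metis
  then show ?thesis
  proof cases
    case 1
    then show ?thesis
      using product_moment_disjoint[of i j k l] I overlap_nonneg by (auto intro: ennreal_leI)
  next
    case 2
    then have "h (X k \<omega>) (X l \<omega>) = h (X i \<omega>) (X j \<omega>)" for \<omega>
      using h_sym by metis
    then have "?E = (\<integral>\<^sup>+ \<omega>. ennreal ((h (X i \<omega>) (X j \<omega>))\<^sup>2) \<partial>M)"
      by (simp only: power2_eq_square)
    also have "\<dots> \<le> ennreal V" using I by (intro second) auto
    also have "\<dots> \<le> ennreal (\<mu>\<^sup>2 + overlap (i, j) (k, l))"
      using 2 nonneg b2 I by (intro ennreal_leI) (auto simp: overlap_def)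
    finally show ?thesis .
  next
    case 3
    have "h (X k \<omega>) (X l \<omega>) = h (X i \<omega>) (X l \<omega>)" for \<omega>
      using 3 h_sym by metis+
    then have "?E \<le> ennreal (b\<^sup>2)"
      using I 3 product_moment_shared[of i j l] by simp
    also have "\<dots> \<le> ennreal (\<mu>\<^sup>2 + overlap (i, j) (k, l))"
      using 3 nonneg b2 I by (intro ennreal_leI) (auto simp: overlap_def)
    finally show ?thesis .
  next
    case 4
    have "h (X k \<omega>) (X l \<omega>) = h (X i \<omega>) (X k \<omega>)" for \<omega>
      using 4 h_sym by metis+
    then have "?E \<le> ennreal (b\<^sup>2)"
      using I 4 product_moment_shared[of i j k] by simp
    also have "\<dots> \<le> ennreal (\<mu>\<^sup>2 + overlap (i, j) (k, l))"
      using 4 nonneg b2 I by (intro ennreal_leI) (auto simp: overlap_def)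
    finally show ?thesis .
  next
    case 5
    have "h (X i \<omega>) (X j \<omega>) = h (X j \<omega>) (X i \<omega>)" "h (X k \<omega>) (X l \<omega>) = h (X j \<omega>) (X l \<omega>)" for \<omega>
      using 5 h_sym by metis+
    then have "?E \<le> ennreal (b\<^sup>2)"
      using I 5 product_moment_shared[of j i l] by simp
    also have "\<dots> \<le> ennreal (\<mu>\<^sup>2 + overlap (i, j) (k, l))"
      using 5 nonneg b2 I by (intro ennreal_leI) (auto simp: overlap_def)
    finally show ?thesis .
  next
    case 6
    have "h (X i \<omega>) (X j \<omega>) = h (X j \<omega>) (X i \<omega>)" "h (X k \<omega>) (X l \<omega>) = h (X j \<omega>) (X k \<omega>)" for \<omega>
      using 6 h_sym by metis+
    then have "?E \<le> ennreal (b\<^sup>2)"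
      using I 6 product_moment_shared[of j i k] by simp
    also have "\<dots> \<le> ennreal (\<mu>\<^sup>2 + overlap (i, j) (k, l))"
      using 6 nonneg b2 I by (intro ennreal_leI) (auto simp: overlap_def)
    finally show ?thesis .
  qed
qed

lemma sum_overlap_le:
  assumes "p \<in> offdiag I"
  shows "(\<Sum>q\<in>offdiag I. overlap p q) \<le> 2 * V + 4 * real (card I) * b\<^sup>2"
proof -
  obtain i j where p: "p = (i, j)" by (cases p)
  have ij: "i \<in> I" "j \<in> I" using assms by (auto simp: p offdiag_def)
  have one: "(\<Sum>l\<in>I. of_bool (i = l)) = (1 :: real)" if "i \<in> I" for i
    using fin that by (simp add: of_bool_def)
  have "(\<Sum>q\<in>offdiag I. overlap p q) \<le> (\<Sum>q\<in>I \<times> I. overlap p q)"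
    using fin by (intro sum_mono2 overlap_nonneg) (auto simp: offdiag_def)
  also have "\<dots> = (\<Sum>k\<in>I. \<Sum>l\<in>I. overlap p (k, l))"
    by (simp add: sum.cartesian_product)
  also have "\<dots> = (\<Sum>k\<in>I. (of_bool (i = k) + of_bool (j = k)) * V +
      real (card I) * ((of_bool (i = k) + of_bool (j = k)) * b\<^sup>2) + 2 * b\<^sup>2)"
  proof (intro sum.cong refl)
    fix k
    have "(\<Sum>l\<in>I. overlap p (k, l)) = (\<Sum>l\<in>I. of_bool (i = k) * V * of_bool (j = l) +
        of_bool (j = k) * V * of_bool (i = l) + (of_bool (i = k) + of_bool (j = k)) * b\<^sup>2 +
        (b\<^sup>2 * of_bool (i = l) + b\<^sup>2 * of_bool (j = l)))"
      by (intro sum.cong refl) (auto simp: overlap_def p)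
    also have "\<dots> = (of_bool (i = k) + of_bool (j = k)) * V +
        real (card I) * ((of_bool (i = k) + of_bool (j = k)) * b\<^sup>2) + 2 * b\<^sup>2"
      unfolding sum.distrib sum_distrib_left[symmetric] one[OF ij(1)] one[OF ij(2)] sum_constant
      by (simp add: distrib_right)
    finally show "(\<Sum>l\<in>I. overlap p (k, l)) = (of_bool (i = k) + of_bool (j = k)) * V +
        real (card I) * ((of_bool (i = k) + of_bool (j = k)) * b\<^sup>2) + 2 * b\<^sup>2" .
  qed
  also have "\<dots> = 2 * V + 4 * real (card I) * b\<^sup>2"
    unfolding sum.distrib sum_distrib_left[symmetric] sum_distrib_right[symmetric]
      one[OF ij(1)] one[OF ij(2)] sum_constant
    by (simp add: algebra_simps)
  finally show ?thesis .
qed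

lemma pair_sum_measurable [measurable]: "pair_sum \<in> borel_measurable M"
  unfolding pair_sum_def case_prod_unfold by measurable

lemma pair_sum_nonneg: "0 \<le> pair_sum \<omega>"
  unfolding pair_sum_def case_prod_unfold by (intro sum_nonneg h_nonneg)

lemma nn_integral_pair_sum: "(\<integral>\<^sup>+ \<omega>. ennreal (pair_sum \<omega>) \<partial>M) = ennreal (card (offdiag I) * \<mu>)"
proof -
  have "(\<integral>\<^sup>+ \<omega>. ennreal (pair_sum \<omega>) \<partial>M) =
      (\<Sum>p\<in>offdiag I. \<integral>\<^sup>+ \<omega>. ennreal (h (X (fst p) \<omega>) (X (snd p) \<omega>)) \<partial>M)"
    by (subst nn_integral_sum[symmetric])
       (auto simp: offdiag_def pair_sum_def case_prod_unfold h_nonneg intro!: nn_integral_cong)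
  also have "\<dots> = (\<Sum>p\<in>offdiag I. ennreal \<mu>)"
    by (intro sum.cong refl mean) (auto simp: offdiag_def)
  finally show ?thesis using nonneg by (simp add: ennreal_mult ennreal_of_nat_eq_real_of_nat)
qed

text \<open>Of the roughly \<open>n\<^sup>4\<close> product moments, those with disjoint index pairs reproduce the square of the
mean; only of the order of \<open>n\<^sup>3\<close> others remain.\<close>

lemma nn_integral_pair_sum_square:
  "(\<integral>\<^sup>+ \<omega>. ennreal ((pair_sum \<omega>)\<^sup>2) \<partial>M) \<le> ennreal ((card (offdiag I) * \<mu>)\<^sup>2 +
     card (offdiag I) * (2 * V + 4 * real (card I) * b\<^sup>2))"
proof -
  let ?P = "offdiag I"
  have "(\<integral>\<^sup>+ \<omega>. ennreal ((pair_sum \<omega>)\<^sup>2) \<partial>M) =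
     (\<integral>\<^sup>+ \<omega>. (\<Sum>p\<in>?P. \<Sum>q\<in>?P. ennreal (h (X (fst p) \<omega>) (X (snd p) \<omega>) * h (X (fst q) \<omega>) (X (snd q) \<omega>))) \<partial>M)"
  proof (intro nn_integral_cong)
    fix \<omega>
    have "(pair_sum \<omega>)\<^sup>2 = (\<Sum>p\<in>?P. \<Sum>q\<in>?P. h (X (fst p) \<omega>) (X (snd p) \<omega>) * h (X (fst q) \<omega>) (X (snd q) \<omega>))"
      unfolding power2_eq_square pair_sum_def case_prod_unfold by (rule sum_product)
    then show "ennreal ((pair_sum \<omega>)\<^sup>2) =
        (\<Sum>p\<in>?P. \<Sum>q\<in>?P. ennreal (h (X (fst p) \<omega>) (X (snd p) \<omega>) * h (X (fst q) \<omega>) (X (snd q) \<omega>)))"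
      by (simp add: h_nonneg sum_nonneg)
  qed
  also have "\<dots> = (\<Sum>p\<in>?P. \<integral>\<^sup>+ \<omega>. (\<Sum>q\<in>?P. ennreal (h (X (fst p) \<omega>) (X (snd p) \<omega>) *
      h (X (fst q) \<omega>) (X (snd q) \<omega>))) \<partial>M)"
    by (rule nn_integral_sum) measurable
  also have "\<dots> = (\<Sum>p\<in>?P. \<Sum>q\<in>?P.
      \<integral>\<^sup>+ \<omega>. ennreal (h (X (fst p) \<omega>) (X (snd p) \<omega>) * h (X (fst q) \<omega>) (X (snd q) \<omega>)) \<partial>M)"
    by (intro sum.cong refl nn_integral_sum) measurable
  also have "\<dots> \<le> (\<Sum>p\<in>?P. \<Sum>q\<in>?P. ennreal (\<mu>\<^sup>2 + overlap p q))"
    by (intro sum_mono) (use product_moment_le in auto)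
  also have "\<dots> = ennreal (\<Sum>p\<in>?P. \<Sum>q\<in>?P. \<mu>\<^sup>2 + overlap p q)"
    by (simp add: sum_ennreal overlap_nonneg sum_nonneg del: ennreal_plus)
  also have "\<dots> \<le> ennreal (\<Sum>p\<in>?P. card ?P * \<mu>\<^sup>2 + (2 * V + 4 * real (card I) * b\<^sup>2))"
    by (intro ennreal_leI sum_mono) (simp add: sum.distrib sum_overlap_le)
  also have "(\<Sum>p\<in>?P. card ?P * \<mu>\<^sup>2 + (2 * V + 4 * real (card I) * b\<^sup>2)) =
      (card (offdiag I) * \<mu>)\<^sup>2 + card (offdiag I) * (2 * V + 4 * real (card I) * b\<^sup>2)"
    by (simp add: power2_eq_square algebra_simps)
  finally show ?thesis .
qed

lemma pair_sum_lower_tail: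
  assumes "t > 0"
  shows "prob {\<omega> \<in> space M. pair_sum \<omega> \<le> card (offdiag I) * \<mu> - t} \<le>
    card (offdiag I) * (2 * V + 4 * real (card I) * b\<^sup>2) / t\<^sup>2"
proof -
  let ?m = "card (offdiag I) * \<mu>" and ?v = "card (offdiag I) * (2 * V + 4 * real (card I) * b\<^sup>2)"
  have v: "0 \<le> ?v" using nonneg by auto
  have int: "integrable M pair_sum"
    by (rule integrableI_nonneg) (auto simp: pair_sum_nonneg nn_integral_pair_sum)
  have int2: "integrable M (\<lambda>\<omega>. (pair_sum \<omega>)\<^sup>2)"
    using le_less_trans[OF nn_integral_pair_sum_square ennreal_less_top]
    by (intro integrableI_nonneg) auto
  have E: "expectation pair_sum = ?m"
    using nn_integral_pair_sum nonneg by (subst integral_eq_nn_integral) (auto simp: pair_sum_nonneg)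
  have "expectation (\<lambda>\<omega>. (pair_sum \<omega>)\<^sup>2) \<le> ?m\<^sup>2 + ?v"
    using nn_integral_pair_sum_square v by (intro integral_real_bounded) auto
  then have var: "variance pair_sum \<le> ?v"
    using variance_eq[OF int int2] E by simp
  have "prob {\<omega> \<in> space M. pair_sum \<omega> \<le> ?m - t} \<le> prob {\<omega> \<in> space M. \<bar>pair_sum \<omega> - expectation pair_sum\<bar> \<ge> t}"
    using assms by (intro finite_measure_mono) (auto simp: E)
  also have "\<dots> \<le> variance pair_sum / t\<^sup>2"
    by (rule Chebyshev_inequality) (use int2 assms in auto)
  also have "\<dots> \<le> ?v / t\<^sup>2" using var by (intro divide_right_mono) auto
  finally show ?thesis .
qed

end

section \<open>Measurability of the edge functional\<close>

text \<open>Coinciding points are counted once in the sum over the image, so this is not a plain sum of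
measurable functions: a new point contributes only on the event that it differs from all
earlier ones.\<close>

lemma measurable_sum_image:
  fixes X :: "'i \<Rightarrow> 'w \<Rightarrow> 'b::{second_countable_topology, t2_space}"
    and g :: "'w \<times> 'b \<Rightarrow> real"
  assumes "finite I" and "\<And>i. i \<in> I \<Longrightarrow> X i \<in> borel_measurable M"
    and "g \<in> borel_measurable (M \<Otimes>\<^sub>M borel)"
  shows "(\<lambda>\<omega>. \<Sum>x\<in>(\<lambda>i. X i \<omega>) ` I. g (\<omega>, x)) \<in> borel_measurable M"
  using assms(1,2)
proof (induction I rule: finite_induct)
  case empty
  then show ?case by simp
next
  case (insert i I)
  note [measurable] = assms(3)
  have [measurable]: "X i \<in> borel_measurable M" "\<And>j. j \<in> I \<Longrightarrow> X j \<in> borel_measurable M"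
      "(\<lambda>\<omega>. \<Sum>x\<in>(\<lambda>i. X i \<omega>) ` I. g (\<omega>, x)) \<in> borel_measurable M"
    using insert by auto
  have [measurable]: "Measurable.pred M (\<lambda>\<omega>. \<exists>j\<in>I. X j \<omega> = X i \<omega>)"
    using \<open>finite I\<close> by (intro pred_intros_finite) auto
  have "(\<lambda>\<omega>. \<Sum>x\<in>(\<lambda>i. X i \<omega>) ` insert i I. g (\<omega>, x)) =
    (\<lambda>\<omega>. (if \<exists>j\<in>I. X j \<omega> = X i \<omega> then 0 else g (\<omega>, X i \<omega>)) + (\<Sum>x\<in>(\<lambda>i. X i \<omega>) ` I. g (\<omega>, x)))"
    using \<open>finite I\<close> by (auto simp: fun_eq_iff insert_absorb image_iff sum.insert_if)
  also have "\<dots> \<in> borel_measurable M" by measurable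
  finally show ?case .
qed

lemma edge_term_measurable [measurable]:
  assumes [measurable]: "u \<in> borel_measurable M" "v \<in> borel_measurable M"
  shows "(\<lambda>\<omega>. edge_term \<beta> r (u \<omega>) (v \<omega>)) \<in> borel_measurable M"
  unfolding edge_term_def by measurable

lemma edge_term_nonneg: "0 \<le> edge_term \<beta> r x y"
  by (simp add: edge_term_def)

lemma edge_term_sym: "edge_term \<beta> r x y = edge_term \<beta> r y x"
  by (simp add: edge_term_def norm_minus_commute)

lemma edge_functional_measurable:
  fixes X :: "'i \<Rightarrow> 'w \<Rightarrow> 'a::euclidean_space"
  assumes I: "finite I" and X: "\<And>i. i \<in> I \<Longrightarrow> X i \<in> borel_measurable M"
  shows "(\<lambda>\<omega>. edge_functional \<beta> r ((\<lambda>i. X i \<omega>) ` I)) \<in> borel_measurable M"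
proof -
  let ?g = "\<lambda>x y :: 'a. if x = y then 0 else edge_term \<beta> r x y"
  have "edge_functional \<beta> r S = 1 / 2 * (\<Sum>x\<in>S. \<Sum>y\<in>S. ?g x y)" if "finite S" for S
  proof -
    have "(\<Sum>x\<in>S. \<Sum>y\<in>S. ?g x y) = (\<Sum>(x, y)\<in>S \<times> S. ?g x y)"
      by (simp add: sum.cartesian_product)
    also have "\<dots> = (\<Sum>(x, y) \<in> {(x, y). x \<in> S \<and> y \<in> S \<and> x \<noteq> y}. edge_term \<beta> r x y)"
      using that by (intro sum.mono_neutral_cong_right) (auto simp: case_prod_unfold)
    finally show ?thesis by (simp add: edge_functional_def)
  qed
  then have eq: "(\<lambda>\<omega>. edge_functional \<beta> r ((\<lambda>i. X i \<omega>) ` I)) =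
      (\<lambda>\<omega>. 1 / 2 * (\<Sum>x\<in>(\<lambda>i. X i \<omega>) ` I. \<Sum>y\<in>(\<lambda>i. X i \<omega>) ` I. ?g x y))"
    using I by auto
  have inner: "(\<lambda>p. \<Sum>y\<in>(\<lambda>i. X i (fst p)) ` I. ?g (snd p) y) \<in> borel_measurable (M \<Otimes>\<^sub>M borel)"
  proof -
    have [measurable]: "X i \<in> borel_measurable M" if "i \<in> I" for i using that by (rule X)
    have "(\<lambda>p. \<Sum>y\<in>(\<lambda>i. X i (fst p)) ` I. (\<lambda>(p, y). ?g (snd p) y) (p, y)) \<in> borel_measurable (M \<Otimes>\<^sub>M borel)"
      using I by (intro measurable_sum_image) (auto simp: case_prod_unfold)
    then show ?thesis by (simp only: prod.case)
  qed
  have "(\<lambda>\<omega>. \<Sum>x\<in>(\<lambda>i. X i \<omega>) ` I. \<Sum>y\<in>(\<lambda>i. X i \<omega>) ` I. ?g x y) \<in> borel_measurable M"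
    using measurable_sum_image[OF I X inner] by (simp only: fst_conv snd_conv)
  then show ?thesis unfolding eq by simp
qed

section \<open>Edge weights and the edge functional of a sample\<close>

text \<open>The integral of \<open>\<parallel>z\<parallel>\<^sup>\<gamma>\<close> over the centred ball of radius \<open>r\<close> in dimension \<open>d\<close>, for \<open>\<gamma> > -d\<close>.\<close>

definition kernel_mass :: "nat \<Rightarrow> real \<Rightarrow> real \<Rightarrow> real" where
  "kernel_mass d \<gamma> r = real d * unit_ball_vol (real d) / (\<gamma> + real d) * r powr (\<gamma> + real d)"

lemma kernel_mass_pos:
  assumes "d \<ge> 1" "\<gamma> > - real d" "r > 0"
  shows "kernel_mass d \<gamma> r > 0"
  using assms by (simp add: kernel_mass_def)

lemma edge_term_eq_difference:
  "edge_term \<beta> r x y = of_bool (norm (y - x) \<le> r) * norm (y - x) powr \<beta>"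
  by (simp add: edge_term_def norm_minus_commute)

lemma edge_term_square: "(edge_term \<beta> r x y)\<^sup>2 = edge_term (2 * \<beta>) r x y"
  by (simp add: edge_term_def power2_eq_square powr_add[symmetric])

lemma nn_integral_edge_term:
  fixes x :: "'a::euclidean_space"
  assumes "\<beta> > - real DIM('a)" "r \<ge> 0"
  shows "(\<integral>\<^sup>+ y. ennreal (edge_term \<beta> r x y) \<partial>lborel) = ennreal (kernel_mass DIM('a) \<beta> r)"
proof -
  have "(\<integral>\<^sup>+ y. ennreal (edge_term \<beta> r x y) \<partial>lborel) =
      (\<integral>\<^sup>+ y. ennreal (of_bool (norm (y + - x) \<le> r) * norm (y + - x) powr \<beta>) \<partial>lborel)"
    by (simp add: edge_term_eq_difference)
  also have "\<dots> = (\<integral>\<^sup>+ (z::'a). ennreal (of_bool (norm z \<le> r) * norm z powr \<beta>) \<partial>lborel)"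
    by (rule nn_integral_lborel_shift) measurable
  finally show ?thesis
    using assms by (simp add: nn_integral_norm_powr_cball kernel_mass_def)
qed

text \<open>Dropping the restriction of \<open>y\<close> to \<open>W\<close> can only increase the integral.  This one-sided comparison
of the two centerings suffices, because under the alternative the edge functional exceeds both.\<close>

lemma set_integral_edge_term_le:
  fixes W :: "'a::euclidean_space set"
  assumes W: "W \<in> sets lebesgue" "emeasure lebesgue W = 1" and \<beta>: "\<beta> > - real DIM('a)" and r: "r > 0"
  shows "(LINT (x, y):W \<times> W|lebesgue. edge_term \<beta> r x y) \<le> kernel_mass DIM('a) \<beta> r"
proof -
  \<comment> \<open>Fubini's theorem is applied to the Borel product, hence a Borel superset \<open>W'\<close> of \<open>W\<close> of the
    same measure.\<close>
  obtain S N N' where SN: "W = S \<union> N" "N \<subseteq> N'" "N' \<in> null_sets lborel" "S \<in> sets lborel"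
    using W(1) by (rule sets_completionE)
  define W' where "W' = S \<union> N'"
  have [measurable]: "W' \<in> sets borel" and sub: "W \<subseteq> W'"
    using SN by (auto simp: W'_def)
  have "emeasure lborel W' = emeasure lborel S"
    using SN by (simp add: W'_def emeasure_Un_null_set)
  also have "\<dots> = emeasure lebesgue S"
    using SN by simp
  also have "\<dots> \<le> emeasure lebesgue W"
    using SN(1) W(1) by (intro emeasure_mono) auto
  finally have W'1: "emeasure lborel W' \<le> 1" using W by simp
  have "(\<integral>\<^sup>+ z. ennreal (indicator (W \<times> W) z *\<^sub>R (case z of (x, y) \<Rightarrow> edge_term \<beta> r x y)) \<partial>lebesgue) =
      (\<integral>\<^sup>+ z. ennreal (indicator (W \<times> W) z *\<^sub>R (case z of (x, y) \<Rightarrow> edge_term \<beta> r x y)) \<partial>lborel)"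
    by (rule nn_integral_completion)
  also have "\<dots> \<le> (\<integral>\<^sup>+ z. indicator W' (fst z) * ennreal (edge_term \<beta> r (fst z) (snd z)) \<partial>lborel)"
    using sub by (intro nn_integral_mono) (auto simp: indicator_def split: prod.splits)
  also have "\<dots> = (\<integral>\<^sup>+ z. indicator W' (fst z) * ennreal (edge_term \<beta> r (fst z) (snd z)) \<partial>(lborel \<Otimes>\<^sub>M lborel))"
    by (simp add: lborel_prod)
  also have "\<dots> = (\<integral>\<^sup>+ x. \<integral>\<^sup>+ y. indicator W' x * ennreal (edge_term \<beta> r x y) \<partial>lborel \<partial>lborel)"
    by (subst lborel.nn_integral_fst[symmetric]) auto
  also have "\<dots> = (\<integral>\<^sup>+ x. indicator W' x * ennreal (kernel_mass DIM('a) \<beta> r) \<partial>lborel)"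
    using \<beta> r by (simp add: nn_integral_cmult nn_integral_edge_term)
  also have "\<dots> = emeasure lborel W' * ennreal (kernel_mass DIM('a) \<beta> r)"
    by (simp add: nn_integral_multc)
  also have "\<dots> \<le> 1 * ennreal (kernel_mass DIM('a) \<beta> r)"
    by (intro mult_right_mono W'1) simp
  finally show ?thesis
    unfolding set_lebesgue_integral_def
    using kernel_mass_pos[of "DIM('a)" \<beta> r] \<beta> r
    by (intro integral_real_bounded) (auto simp: Suc_le_eq)
qed

lemma edge_functional_inj:
  assumes "inj_on x I"
  shows "2 * edge_functional \<beta> r (x ` I) = (\<Sum>(i, j)\<in>offdiag I. edge_term \<beta> r (x i) (x j))"
proof -
  have "(\<Sum>(x, y) \<in> {(u, v). u \<in> x ` I \<and> v \<in> x ` I \<and> u \<noteq> v}. edge_term \<beta> r x y) =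
      (\<Sum>(i, j)\<in>offdiag I. edge_term \<beta> r (x i) (x j))"
  proof (rule sum.reindex_cong[where l = "map_prod x x"])
    show "inj_on (map_prod x x) (offdiag I)"
      using assms by (auto simp: inj_on_def offdiag_def)
    show "{(u, v). u \<in> x ` I \<and> v \<in> x ` I \<and> u \<noteq> v} = map_prod x x ` offdiag I"
      using assms by (auto simp: offdiag_def inj_on_eq_iff image_iff)
  qed auto
  then show ?thesis by (simp add: edge_functional_def)
qed

locale density_sample = prob_space M for M :: "'w measure" +
  fixes f :: "'a::euclidean_space \<Rightarrow> real" and X :: "'i \<Rightarrow> 'w \<Rightarrow> 'a" and I :: "'i set"
  assumes f_meas [measurable]: "f \<in> borel_measurable borel"
    and f_nonneg: "\<And>x. 0 \<le> f x"
    and f_int: "(\<integral>\<^sup>+ x. ennreal (f x) \<partial>lborel) = 1"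
    and X_indep: "indep_vars (\<lambda>_. borel) X I"
    and X_dens: "\<And>i. i \<in> I \<Longrightarrow> distributed M lborel (X i) (\<lambda>x. ennreal (f x))"
    and I_fin: "finite I"
begin

lemma nn_integral_sample:
  assumes "i \<in> I" and [measurable]: "u \<in> borel_measurable borel"
  shows "(\<integral>\<^sup>+ \<omega>. u (X i \<omega>) \<partial>M) = (\<integral>\<^sup>+ x. ennreal (f x) * u x \<partial>lborel)"
  using distributed_nn_integral[OF X_dens[OF assms(1)], of u] by simp

lemma nn_integral_sample_pair:
  fixes u :: "'a \<Rightarrow> 'a \<Rightarrow> ennreal"
  assumes ij: "i \<in> I" "j \<in> I" "i \<noteq> j" and [measurable]: "case_prod u \<in> borel_measurable (borel \<Otimes>\<^sub>M borel)"
  shows "(\<integral>\<^sup>+ \<omega>. u (X i \<omega>) (X j \<omega>) \<partial>M) =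
    (\<integral>\<^sup>+ x. ennreal (f x) * (\<integral>\<^sup>+ y. ennreal (f y) * u x y \<partial>lborel) \<partial>lborel)"
proof -
  have "(\<integral>\<^sup>+ \<omega>. u (X i \<omega>) (X j \<omega>) \<partial>M) = (\<integral>\<^sup>+ \<omega>. \<integral>\<^sup>+ \<omega>'. u (X i \<omega>) (X j \<omega>') \<partial>M \<partial>M)"
    using nn_integral_indep_pair[OF indep_vars_imp_indep_var_pair[OF X_indep ij], of "case_prod u"]
    by simp
  also have "\<dots> = (\<integral>\<^sup>+ \<omega>. (\<integral>\<^sup>+ y. ennreal (f y) * u (X i \<omega>) y \<partial>lborel) \<partial>M)"
    using ij by (intro nn_integral_cong nn_integral_sample) auto
  also have "\<dots> = (\<integral>\<^sup>+ x. ennreal (f x) * (\<integral>\<^sup>+ y. ennreal (f y) * u x y \<partial>lborel) \<partial>lborel)"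
    using ij by (intro nn_integral_sample) auto
  finally show ?thesis .
qed

text \<open>The law of a sample point has no atoms, so coincidences are null events, and the edge functional of the
point set is almost surely a sum over pairs of indices.\<close>

lemma AE_sample_inj: "AE \<omega> in M. inj_on (\<lambda>i. X i \<omega>) I"
proof -
  have [measurable]: "X i \<in> borel_measurable M" if "i \<in> I" for i
    using X_indep that unfolding indep_vars_def by blast
  have "AE \<omega> in M. X i \<omega> \<noteq> X j \<omega>" if ij: "i \<in> I" "j \<in> I" "i \<noteq> j" for i j
  proof -
    note [measurable] = ij(1,2)
    have "(\<integral>\<^sup>+ \<omega>. of_bool (X i \<omega> = X j \<omega>) \<partial>M) =
        (\<integral>\<^sup>+ x. ennreal (f x) * (\<integral>\<^sup>+ y. ennreal (f y) * of_bool (x = y) \<partial>lborel) \<partial>lborel)"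
      using ij by (intro nn_integral_sample_pair[of i j "\<lambda>x y. of_bool (x = y)"]) auto
    moreover have "(\<integral>\<^sup>+ y. ennreal (f y) * of_bool (x = y) \<partial>lborel) = 0" for x :: 'a
      using AE_lborel_singleton[of x] by (subst nn_integral_0_iff_AE) (auto elim!: eventually_mono)
    ultimately have "(\<integral>\<^sup>+ \<omega>. of_bool (X i \<omega> = X j \<omega>) \<partial>M) = 0"
      by simp
    then show ?thesis
      by (subst (asm) nn_integral_0_iff_AE) (auto elim!: eventually_mono)
  qed
  then have "AE \<omega> in M. \<forall>i\<in>I. \<forall>j\<in>I. i \<noteq> j \<longrightarrow> X i \<omega> \<noteq> X j \<omega>"
    using I_fin by (auto intro!: AE_finite_allI)
  then show ?thesis by eventually_elim (auto simp: inj_on_def)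
qed

text \<open>Keeping only the edges between points where \<open>f \<le> m\<close> lowers the edge functional and leaves a pair
sum with kernel \<open>h\<close>.  Its mean per pair is the autocorrelation of the truncated density
integrated against \<open>\<parallel>z\<parallel>\<^sup>\<beta>\<close> on the ball of radius \<open>r\<close>, thus at least \<open>c a\<close>; since one factor \<open>f\<close> is
bounded by \<open>m\<close> and the other integrates to one, the constants of the second moment bound are
\<open>m v\<close> and \<open>m a\<close>.\<close>

lemma edge_functional_lower_tail:
  assumes m: "m > 0" and r: "r > 0" "r < \<rho>" and \<beta>: "\<beta> > - (real DIM('a) / 2)" and t: "t > 0"
    and c: "c \<ge> 0"
    and corr: "\<And>z. norm z < \<rho> \<Longrightarrow>
      ennreal c \<le> (\<integral>\<^sup>+ x. ennreal ((of_bool (f x \<le> m) * f x) * (of_bool (f (x + z) \<le> m) * f (x + z))) \<partial>lborel)"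
  defines "n \<equiv> real (card I)" and "a \<equiv> kernel_mass DIM('a) \<beta> r" and "v \<equiv> kernel_mass DIM('a) (2 * \<beta>) r"
  shows "prob {\<omega> \<in> space M. 2 * edge_functional \<beta> r ((\<lambda>i. X i \<omega>) ` I) \<le> n * (n - 1) * (c * a) - t} \<le>
    n * (n - 1) * (2 * (m * v) + 4 * n * (m * a)\<^sup>2) / t\<^sup>2"
proof -
  have \<beta>': "\<beta> > - real DIM('a)" "2 * \<beta> > - real DIM('a)" using \<beta> by (auto simp: field_simps)
  have av: "a > 0" "v > 0"
    unfolding a_def v_def using \<beta>' r by (auto intro!: kernel_mass_pos simp: Suc_le_eq)
  define h where "h = (\<lambda>x y. of_bool (f x \<le> m) * of_bool (f y \<le> m) * edge_term \<beta> r x y)"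
  define g where "g = (\<lambda>x. of_bool (f x \<le> m) * f x)"
  define k where "k = (\<lambda>z::'a. of_bool (norm z \<le> r) * norm z powr \<beta>)"
  have [measurable]: "g \<in> borel_measurable borel" "k \<in> borel_measurable borel"
      "case_prod h \<in> borel_measurable (borel \<Otimes>\<^sub>M borel)"
    unfolding g_def k_def h_def case_prod_unfold by measurable
  have h_section: "(\<integral>\<^sup>+ y. ennreal (f y) * ennreal (h x y) \<partial>lborel) \<le> ennreal (m * a)" for x
  proof -
    have "(\<integral>\<^sup>+ y. ennreal (f y) * ennreal (h x y) \<partial>lborel) \<le> (\<integral>\<^sup>+ y. ennreal m * ennreal (edge_term \<beta> r x y) \<partial>lborel)"
      using f_nonneg m
      by (intro nn_integral_mono) (auto simp: h_def edge_term_nonneg intro!: mult_mono ennreal_leI)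
    also have "\<dots> = ennreal (m * a)"
      using \<beta>' r m by (simp add: nn_integral_cmult nn_integral_edge_term a_def ennreal_mult')
    finally show ?thesis .
  qed
  have h_section2: "(\<integral>\<^sup>+ y. ennreal (f y) * ennreal ((h x y)\<^sup>2) \<partial>lborel) \<le> ennreal (m * v)" for x
  proof -
    have "(\<integral>\<^sup>+ y. ennreal (f y) * ennreal ((h x y)\<^sup>2) \<partial>lborel) \<le> (\<integral>\<^sup>+ y. ennreal m * ennreal (edge_term (2 * \<beta>) r x y) \<partial>lborel)"
      using f_nonneg m
      by (intro nn_integral_mono)
         (auto simp: h_def edge_term_nonneg edge_term_square power_mult_distrib intro!: mult_mono ennreal_leI)
    also have "\<dots> = ennreal (m * v)"
      using \<beta>' r m by (simp add: nn_integral_cmult nn_integral_edge_term v_def ennreal_mult')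
    finally show ?thesis .
  qed
  define E where "E = (\<integral>\<^sup>+ x. ennreal (f x) * (\<integral>\<^sup>+ y. ennreal (f y) * ennreal (h x y) \<partial>lborel) \<partial>lborel)"
  have average: "(\<integral>\<^sup>+ x. ennreal (f x) * u x \<partial>lborel) \<le> b" if "\<And>x. u x \<le> b" for u :: "'a \<Rightarrow> ennreal" and b
  proof -
    have "(\<integral>\<^sup>+ x. ennreal (f x) * u x \<partial>lborel) \<le> (\<integral>\<^sup>+ x. ennreal (f x) * b \<partial>lborel)"
      using that by (intro nn_integral_mono mult_left_mono) auto
    then show ?thesis by (simp add: nn_integral_multc f_int)
  qed
  have E_le: "E \<le> ennreal (m * a)" unfolding E_def by (intro average h_section)
  define \<mu> where "\<mu> = enn2real E"
  have E: "E = ennreal \<mu>"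
    unfolding \<mu>_def using E_le by (subst ennreal_enn2real) (auto simp: less_top[symmetric] top_unique)
  have "ennreal c * (\<integral>\<^sup>+ z. ennreal (k z) \<partial>lborel) \<le>
      (\<integral>\<^sup>+ x. \<integral>\<^sup>+ y. ennreal (g x * g y * k (y - x)) \<partial>lborel \<partial>lborel)"
  proof (rule convolution_pairing_lower_bound)
    fix z assume "k z \<noteq> 0"
    then have "norm z < \<rho>" using r by (auto simp: k_def split: if_splits)
    then show "ennreal c \<le> (\<integral>\<^sup>+ x. ennreal (g x * g (x + z)) \<partial>lborel)"
      using corr unfolding g_def by blast
  qed (auto simp: g_def k_def f_nonneg)
  also have "(\<integral>\<^sup>+ z. ennreal (k z) \<partial>lborel) = ennreal a"
    using \<beta>' r unfolding k_def by (simp add: nn_integral_norm_powr_cball a_def kernel_mass_def)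
  also have "(\<integral>\<^sup>+ x. \<integral>\<^sup>+ y. ennreal (g x * g y * k (y - x)) \<partial>lborel \<partial>lborel) = E"
    unfolding E_def
  proof (rule nn_integral_cong)
    fix x
    have "ennreal (g x * g y * k (y - x)) = ennreal (f x) * (ennreal (f y) * ennreal (h x y))" for y
      using f_nonneg
      by (auto simp: g_def k_def h_def edge_term_eq_difference ac_simps simp flip: ennreal_mult)
    then show "(\<integral>\<^sup>+ y. ennreal (g x * g y * k (y - x)) \<partial>lborel) =
        ennreal (f x) * (\<integral>\<^sup>+ y. ennreal (f y) * ennreal (h x y) \<partial>lborel)"
      by (simp add: nn_integral_cmult)
  qed
  finally have "ennreal (c * a) \<le> ennreal \<mu>"
    using c av by (simp add: ennreal_mult' E)
  then have \<mu>: "c * a \<le> \<mu>" by (simp add: \<mu>_def)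
  interpret symmetric_kernel_sample M borel X I h \<mu> "m * v" "m * a"
  proof unfold_locales
    show "finite I" by (rule I_fin)
    show "indep_vars (\<lambda>_. borel) X I" by (rule X_indep)
    show "0 \<le> \<mu>" by (simp add: \<mu>_def)
    show "(\<integral>\<^sup>+ \<omega>. ennreal (h (X i \<omega>) (X j \<omega>)) \<partial>M) = ennreal \<mu>" if "i \<in> I" "j \<in> I" "i \<noteq> j" for i j
      using nn_integral_sample_pair[OF that, of "\<lambda>x y. ennreal (h x y)"] by (simp add: E_def flip: E)
    show "(\<integral>\<^sup>+ \<omega>. ennreal ((h (X i \<omega>) (X j \<omega>))\<^sup>2) \<partial>M) \<le> ennreal (m * v)" if "i \<in> I" "j \<in> I" "i \<noteq> j" for i j
      using nn_integral_sample_pair[OF that, of "\<lambda>x y. ennreal ((h x y)\<^sup>2)"] by (simp add: average h_section2)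
    show "(\<integral>\<^sup>+ \<omega>. ennreal (h x (X i \<omega>)) \<partial>M) \<le> ennreal (m * a)" if "i \<in> I" for i x
      using nn_integral_sample[OF that, of "\<lambda>y. ennreal (h x y)"] h_section by simp
  qed (use av m in \<open>auto simp: h_def edge_term_nonneg edge_term_sym ac_simps\<close>)
  have card: "real (card (offdiag I)) = n * (n - 1)"
    using card_offdiag[OF I_fin] by (simp add: n_def)
  have pair_le: "AE \<omega> in M. pair_sum \<omega> \<le> 2 * edge_functional \<beta> r ((\<lambda>i. X i \<omega>) ` I)"
    using AE_sample_inj
  proof eventually_elim
    case (elim \<omega>)
    show ?case
      unfolding edge_functional_inj[OF elim] pair_sum_def
      by (intro sum_mono) (auto simp: h_def edge_term_nonneg)
  qed
  have le: "n * (n - 1) * (c * a) \<le> card (offdiag I) * \<mu>"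
    unfolding card[symmetric] using \<mu> by (intro mult_left_mono) auto
  have "prob {\<omega> \<in> space M. 2 * edge_functional \<beta> r ((\<lambda>i. X i \<omega>) ` I) \<le> n * (n - 1) * (c * a) - t} \<le>
      prob {\<omega> \<in> space M. pair_sum \<omega> \<le> card (offdiag I) * \<mu> - t}"
    using pair_le by (intro finite_measure_mono_AE) (use le in \<open>auto elim!: eventually_mono\<close>)
  also have "\<dots> \<le> card (offdiag I) * (2 * (m * v) + 4 * real (card I) * (m * a)\<^sup>2) / t\<^sup>2"
    using pair_sum_lower_tail[OF t] .
  finally show ?thesis by (simp add: card n_def)
qed

end

section \<open>Divergence of the test statistics\<close>

text \<open>A centering \<open>c'\<close> below \<open>c\<close> is allowed, so that one tail estimate serves both test statistics.\<close>

lemma (in prob_space) standardized_square_tends_to_infinity: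
  assumes L: "\<And>n. L n \<in> borel_measurable M"
    and tail: "\<And>K. K > 0 \<Longrightarrow> (\<lambda>n. prob {\<omega> \<in> space M. L n \<omega> \<le> c n + K * \<sigma> n}) \<longlonglongrightarrow> 0"
    and ev: "eventually (\<lambda>n. \<sigma> n > 0 \<and> c' n \<le> c n) sequentially"
  shows "tends_to_infinity_in_prob M (\<lambda>n \<omega>. ((L n \<omega> - c' n) / \<sigma> n)\<^sup>2)"
  unfolding tends_to_infinity_in_prob_def
proof (intro allI impI)
  fix K :: real assume K: "K > 0"
  note [measurable] = L
  let ?p = "\<lambda>n. prob {\<omega> \<in> space M. L n \<omega> \<le> c n + sqrt K * \<sigma> n}"
  have "(\<lambda>n. 1 - ?p n) \<longlonglongrightarrow> 1 - 0"
    using K by (intro tendsto_diff tendsto_const tail) auto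
  then have lim: "(\<lambda>n. 1 - ?p n) \<longlonglongrightarrow> 1" by simp
  show "(\<lambda>n. prob {\<omega> \<in> space M. ((L n \<omega> - c' n) / \<sigma> n)\<^sup>2 > K}) \<longlonglongrightarrow> 1"
  proof (rule tendsto_sandwich[OF _ _ lim tendsto_const])
    show "\<forall>\<^sub>F n in sequentially. 1 - ?p n \<le> prob {\<omega> \<in> space M. ((L n \<omega> - c' n) / \<sigma> n)\<^sup>2 > K}"
      using ev
    proof eventually_elim
      case (elim n)
      have "1 - ?p n = prob (space M - {\<omega> \<in> space M. L n \<omega> \<le> c n + sqrt K * \<sigma> n})"
        by (rule prob_compl[symmetric]) measurable
      also have "\<dots> \<le> prob {\<omega> \<in> space M. ((L n \<omega> - c' n) / \<sigma> n)\<^sup>2 > K}"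
      proof (rule finite_measure_mono)
        show "space M - {\<omega> \<in> space M. L n \<omega> \<le> c n + sqrt K * \<sigma> n} \<subseteq>
            {\<omega> \<in> space M. ((L n \<omega> - c' n) / \<sigma> n)\<^sup>2 > K}"
        proof safe
          fix \<omega> assume "\<not> L n \<omega> \<le> c n + sqrt K * \<sigma> n"
          then have "sqrt K < (L n \<omega> - c' n) / \<sigma> n"
            using elim by (simp add: pos_less_divide_eq)
          then have "(sqrt K)\<^sup>2 < ((L n \<omega> - c' n) / \<sigma> n)\<^sup>2"
            using K by (intro power_strict_mono) auto
          then show "K < ((L n \<omega> - c' n) / \<sigma> n)\<^sup>2" using K by simp
        qed
      qed measurable
      finally show ?case .
    qed
  qed auto
qed

lemma test_scale_pos:
  assumes "d \<ge> 1" "\<beta> > - (real d / 2)" "r > 0" "n \<ge> 1"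
  shows "test_scale d \<beta> r n > 0"
proof -
  have "2 * \<beta> + real d > 0" using assms(2) by (simp add: field_simps)
  then show ?thesis using assms by (simp add: test_scale_def)
qed

text \<open>The squared denominator is \<open>n\<^sup>2/2\<close> times the integral of a squared edge weight over one endpoint.\<close>

lemma test_scale_square:
  assumes "\<beta> > - (real d / 2)" "n \<ge> 1"
  shows "kernel_mass d (2 * \<beta>) r = 2 * (test_scale d \<beta> r n)\<^sup>2 / (real n)\<^sup>2"
proof -
  define D q where "D = real d * unit_ball_vol (real d)" and "q = 2 * \<beta> + real d"
  have q: "q > 0" and D: "D \<ge> 0" using assms(1) by (auto simp: q_def D_def field_simps)
  have "(r powr (\<beta> + real d / 2))\<^sup>2 = r powr q"
    by (simp add: power2_eq_square powr_add[symmetric] q_def)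
  then have "(test_scale d \<beta> r n)\<^sup>2 = D / (2 * q) * (real n)\<^sup>2 * r powr q"
    using q D by (simp add: test_scale_def power_mult_distrib flip: D_def q_def)
  moreover have "kernel_mass d (2 * \<beta>) r = D / q * r powr q"
    by (simp add: kernel_mass_def D_def q_def)
  ultimately show ?thesis using assms(2) q by simp
qed

text \<open>The ratio is a constant times \<open>(n - 1) r\<^sub>n\<^bsup>d/2\<^esup>\<close>; this is where \<open>n\<^sup>2 r\<^sub>n\<^sup>d \<rightarrow> \<infinity>\<close> enters.\<close>

lemma signal_to_noise_at_top:
  assumes d: "d \<ge> 1" and \<beta>: "\<beta> > - (real d / 2)" and r_pos: "\<And>n. n \<ge> 2 \<Longrightarrow> r n > 0"
    and nr: "filterlim (\<lambda>n. (real n)\<^sup>2 * r n ^ d) at_top sequentially"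
  shows "filterlim (\<lambda>n. real n * (real n - 1) * kernel_mass d \<beta> (r n) / test_scale d \<beta> (r n) n)
    at_top sequentially"
proof -
  define D where "D = real d * unit_ball_vol (real d)"
  define q where "q = sqrt (D / (2 * (2 * \<beta> + real d)))"
  define C where "C = D / (\<beta> + real d) / q"
  have pos: "D > 0" "2 * \<beta> + real d > 0" "\<beta> + real d > 0"
    using d \<beta> by (auto simp: D_def field_simps)
  have q: "q > 0" and C: "C > 0" using pos by (auto simp: q_def C_def)
  have lim: "filterlim (\<lambda>n. C / 2 * sqrt ((real n)\<^sup>2 * r n ^ d)) at_top sequentially"
    using C by (intro filterlim_tendsto_pos_mult_at_top[OF tendsto_const] filterlim_compose[OF sqrt_at_top nr]) auto
  show ?thesis
  proof (rule filterlim_at_top_mono[OF lim])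
    show "\<forall>\<^sub>F n in sequentially. C / 2 * sqrt ((real n)\<^sup>2 * r n ^ d) \<le>
        real n * (real n - 1) * kernel_mass d \<beta> (r n) / test_scale d \<beta> (r n) n"
      using eventually_ge_at_top[of 2]
    proof eventually_elim
      case (elim n)
      have r: "r n > 0" using r_pos elim by simp
      have "sqrt ((real n)\<^sup>2 * r n ^ d) = real n * r n powr (real d / 2)"
      proof -
        have "sqrt (r n ^ d) = (r n powr real d) powr (1 / 2)"
          using r by (simp add: powr_half_sqrt powr_realpow)
        then show ?thesis by (simp add: real_sqrt_mult powr_powr)
      qed
      then have "C / 2 * sqrt ((real n)\<^sup>2 * r n ^ d) = C * (real n / 2) * r n powr (real d / 2)"
        by simp
      also have "\<dots> \<le> C * (real n - 1) * r n powr (real d / 2)"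
        using C elim by (intro mult_right_mono mult_left_mono) auto
      also have "\<dots> = real n * (real n - 1) * kernel_mass d \<beta> (r n) / test_scale d \<beta> (r n) n"
      proof -
        have "r n powr (\<beta> + real d) = r n powr (real d / 2) * r n powr (\<beta> + real d / 2)"
          by (simp add: powr_add[symmetric] add.commute)
        then have "kernel_mass d \<beta> (r n) = D / (\<beta> + real d) * r n powr (real d / 2) * r n powr (\<beta> + real d / 2)"
          by (simp add: kernel_mass_def D_def)
        moreover have "test_scale d \<beta> (r n) n = q * real n * r n powr (\<beta> + real d / 2)"
          by (simp add: test_scale_def q_def D_def)
        ultimately show ?thesis using r elim q by (simp add: C_def)
      qed
      finally show ?case .
    qed
  qed
qed

text \<open>The tail bound for pair sums with \<open>v = 2 \<sigma>\<^sup>2 / n\<^sup>2\<close> and deviation \<open>t = n (n - 1) (c - 1) a / 2\<close>,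
half of the excess of the mean, expressed through the signal-to-noise ratio \<open>n (n - 1) a / \<sigma>\<close>.\<close>

lemma relative_variance_bound:
  fixes n a \<sigma> m c :: real
  assumes "n \<ge> 2" "a > 0" "\<sigma> > 0" "m > 0" "c > 1"
  shows "n * (n - 1) * (2 * (m * (2 * \<sigma>\<^sup>2 / n\<^sup>2)) + 4 * n * (m * a)\<^sup>2) / (n * (n - 1) * (c - 1) * a / 2)\<^sup>2 \<le>
    4 / (c - 1)\<^sup>2 * (4 * m / (n * (n - 1) * a / \<sigma>)\<^sup>2 + 4 * m\<^sup>2 / (n - 1))"
proof -
  define N where "N = n * (n - 1)"
  have N: "N > 0" "N \<le> n\<^sup>2" using assms by (auto simp: N_def power2_eq_square)
  have "N * (2 * (m * (2 * \<sigma>\<^sup>2 / n\<^sup>2)) + 4 * n * (m * a)\<^sup>2) / (N * (c - 1) * a / 2)\<^sup>2 =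
      4 / (c - 1)\<^sup>2 * (4 * m * \<sigma>\<^sup>2 / (n\<^sup>2 * N * a\<^sup>2) + 4 * m\<^sup>2 * n / N)"
    using N assms by (simp add: divide_simps power2_eq_square)
  also have "\<dots> \<le> 4 / (c - 1)\<^sup>2 * (4 * m / (N * a / \<sigma>)\<^sup>2 + 4 * m\<^sup>2 / (n - 1))"
  proof (intro mult_left_mono add_mono)
    have "4 * m * \<sigma>\<^sup>2 / (n\<^sup>2 * N * a\<^sup>2) \<le> 4 * m * \<sigma>\<^sup>2 / (N * N * a\<^sup>2)"
      using N assms by (intro divide_left_mono mult_right_mono) auto
    also have "\<dots> = 4 * m / (N * a / \<sigma>)\<^sup>2"
      by (simp add: power2_eq_square)
    finally show "4 * m * \<sigma>\<^sup>2 / (n\<^sup>2 * N * a\<^sup>2) \<le> 4 * m / (N * a / \<sigma>)\<^sup>2" .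
    show "4 * m\<^sup>2 * n / N \<le> 4 * m\<^sup>2 / (n - 1)"
      using assms by (simp add: N_def)
  qed simp
  finally show ?thesis by (simp only: N_def)
qed

theorem theorem3p1:
  fixes W :: "'a::euclidean_space set"
    and f :: "'a \<Rightarrow> real"
    and M :: "'w measure"
    and X :: "nat \<Rightarrow> 'w \<Rightarrow> 'a"
    and r :: "nat \<Rightarrow> real"
    and \<beta> :: real
  assumes W_meas: "W \<in> sets lebesgue"
    and W_vol: "emeasure lebesgue W = 1"
    and f_meas: "f \<in> borel_measurable borel"
    and f_nonneg: "\<And>x. 0 \<le> f x"
    and f_int: "(\<integral>\<^sup>+ x. ennreal (f x) \<partial>lborel) = 1"
    and f_supp: "{x. f x \<noteq> 0} \<subseteq> W"
    and M: "prob_space M"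
    and X_indep: "prob_space.indep_vars M (\<lambda>_. borel) X {1..}"
    and X_dens: "\<And>i. i \<ge> 1 \<Longrightarrow> distributed M lborel (X i) (\<lambda>x. ennreal (f x))"
    and r_pos: "\<And>n. n \<ge> 2 \<Longrightarrow> r n > 0"
    and r_lim: "r \<longlonglongrightarrow> 0"
    and \<beta>: "\<beta> > - (real DIM('a) / 2)"
    and f_neq: "\<not> (AE x in lebesgue. x \<in> W \<longrightarrow> f x = indicator W x)"
    and nr: "filterlim (\<lambda>n. (real n)\<^sup>2 * r n ^ DIM('a)) at_top sequentially"
  shows "tends_to_infinity_in_prob M (\<lambda>n \<omega>. T_e W \<beta> (r n) n ((\<lambda>i. X i \<omega>) ` {1..n})) \<and>
         tends_to_infinity_in_prob M (\<lambda>n \<omega>. T_a \<beta> (r n) n ((\<lambda>i. X i \<omega>) ` {1..n}))"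
proof -
  interpret prob_space M by (rule M)
  define d where "d = DIM('a)"
  have d: "d \<ge> 1" by (simp add: d_def Suc_le_eq)
  have \<beta>': "\<beta> > - (real d / 2)" "\<beta> > - real d" using \<beta> by (auto simp: d_def)
  note [measurable] = f_meas
  obtain m where m: "m > 0" "1 < (\<integral>\<^sup>+ x. ennreal ((of_bool (f x \<le> m) * f x)\<^sup>2) \<partial>lborel)"
    using truncated_square_integral[of f lborel 1]
      density_square_integral_gt_1[OF W_meas W_vol f_meas f_nonneg f_int f_supp f_neq] by auto
  define g where "g = (\<lambda>x. of_bool (f x \<le> m) * f x)"
  obtain c where c: "c > 1" "ennreal c < (\<integral>\<^sup>+ x. ennreal ((g x)\<^sup>2) \<partial>lborel)"
  proof -
    obtain y where y: "1 < y" "y < (\<integral>\<^sup>+ x. ennreal ((g x)\<^sup>2) \<partial>lborel)"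
      using dense[OF m(2)] by (auto simp: g_def)
    obtain c where "y = ennreal c" "c \<ge> 0"
      using y by (cases y rule: ennreal_cases) auto
    then show ?thesis using y that by simp
  qed
  have g: "integrable lborel g"
  proof (rule integrableI_nonneg)
    have "(\<integral>\<^sup>+ x. ennreal (g x) \<partial>lborel) \<le> (\<integral>\<^sup>+ x. ennreal (f x) \<partial>lborel)"
      using f_nonneg by (intro nn_integral_mono ennreal_leI) (auto simp: g_def)
    then show "(\<integral>\<^sup>+ x. ennreal (g x) \<partial>lborel) < \<infinity>"
      by (auto simp: f_int intro: le_less_trans)
  qed (auto simp: g_def f_nonneg)
  obtain \<delta> where \<delta>: "\<delta> > 0" "\<And>z. norm z < \<delta> \<Longrightarrow> ennreal c \<le> (\<integral>\<^sup>+ x. ennreal (g x * g (x + z)) \<partial>lborel)"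
  proof -
    have "0 \<le> g x" "g x \<le> m" for x using f_nonneg m(1) by (auto simp: g_def of_bool_def)
    then show ?thesis
      using autocorrelation_lower_bound[OF g _ _ m(1) _ c(2)] c(1) that by auto
  qed
  define L where "L = (\<lambda>n \<omega>. edge_functional \<beta> (r n) ((\<lambda>i. X i \<omega>) ` {1..n}))"
  define a where "a = (\<lambda>n. kernel_mass d \<beta> (r n))"
  define \<sigma> where "\<sigma> = (\<lambda>n. test_scale d \<beta> (r n) n)"
  define center where "center = (\<lambda>n. 1 / 2 * real n * (real n - 1) * a n)"
  define snr where "snr = (\<lambda>n. real n * (real n - 1) * a n / \<sigma> n)"
  have X_meas: "X i \<in> borel_measurable M" if "i \<ge> 1" for i
    using X_indep that unfolding indep_vars_def by auto
  have L_meas: "L n \<in> borel_measurable M" for n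
    unfolding L_def using X_meas by (intro edge_functional_measurable) auto
  have snr: "filterlim snr at_top sequentially"
    unfolding snr_def a_def \<sigma>_def
    using signal_to_noise_at_top[OF d \<beta>'(1) r_pos] nr by (simp add: d_def)
  have tail: "(\<lambda>n. prob {\<omega> \<in> space M. L n \<omega> \<le> center n + K * \<sigma> n}) \<longlonglongrightarrow> 0" if K: "K > 0" for K
  proof (rule tendsto_sandwich[OF _ _ tendsto_const])
    let ?b = "\<lambda>n. 4 / (c - 1)\<^sup>2 * (4 * m / (snr n)\<^sup>2 + 4 * m\<^sup>2 / (real n - 1))"
    have n1: "filterlim (\<lambda>n. real n - 1) at_top sequentially"
      using filterlim_tendsto_add_at_top[OF tendsto_const[of "-1 :: real"] filterlim_real_sequentially]
      by simp
    have "(\<lambda>n. 4 * m / (snr n)\<^sup>2) \<longlonglongrightarrow> 0"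
      by (intro tendsto_divide_0[OF tendsto_const] filterlim_at_top_imp_at_infinity
          filterlim_pow_at_top snr) simp
    moreover have "(\<lambda>n. 4 * m\<^sup>2 / (real n - 1)) \<longlonglongrightarrow> 0"
      by (intro tendsto_divide_0[OF tendsto_const] filterlim_at_top_imp_at_infinity n1)
    ultimately have "?b \<longlonglongrightarrow> 4 / (c - 1)\<^sup>2 * (0 + 0)"
      by (intro tendsto_mult tendsto_add tendsto_const)
    then show "?b \<longlonglongrightarrow> 0" by simp
    \<comment> \<open>From here on \<open>K \<sigma>\<close> is at most a quarter of \<open>n (n - 1) (c - 1) a\<close>, which leaves room for the
      deviation \<open>t\<close> below.\<close>
    have "eventually (\<lambda>n. snr n \<ge> 4 * K / (c - 1)) sequentially"
      using snr by (simp add: filterlim_at_top)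
    moreover have "eventually (\<lambda>n. r n < \<delta>) sequentially"
      using r_lim \<delta>(1) by (rule order_tendstoD)
    ultimately show "\<forall>\<^sub>F n in sequentially. prob {\<omega> \<in> space M. L n \<omega> \<le> center n + K * \<sigma> n} \<le> ?b n"
      using eventually_ge_at_top[of 2]
    proof eventually_elim
      case (elim n)
      have r: "r n > 0" and n: "n \<ge> 2" "real n \<ge> 2" using elim r_pos by auto
      interpret density_sample M f X "{1..n}"
      proof unfold_locales
        show "indep_vars (\<lambda>_. borel) X {1..n}"
          by (rule indep_vars_subset[OF X_indep]) auto
      qed (auto simp: f_nonneg f_int X_dens)
      have a: "a n > 0" and \<sigma>: "\<sigma> n > 0"
        unfolding a_def \<sigma>_def using d \<beta>' r n by (auto intro!: kernel_mass_pos test_scale_pos)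
      let ?N = "real n * (real n - 1)"
      let ?t = "?N * (c - 1) * a n / 2"
      have t: "?t > 0" using n a c by simp
      have "4 * K / (c - 1) \<le> ?N * a n / \<sigma> n" using elim by (simp add: snr_def)
      then have K_le: "4 * K * \<sigma> n \<le> ?N * a n * (c - 1)"
        using \<sigma> c by (simp add: field_simps)
      have "prob {\<omega> \<in> space M. L n \<omega> \<le> center n + K * \<sigma> n} \<le>
          prob {\<omega> \<in> space M. 2 * L n \<omega> \<le> ?N * (c * a n) - ?t}"
      proof (rule finite_measure_mono)
        show "{\<omega> \<in> space M. L n \<omega> \<le> center n + K * \<sigma> n} \<subseteq>
            {\<omega> \<in> space M. 2 * L n \<omega> \<le> ?N * (c * a n) - ?t}"
        proof safe
          fix \<omega> assume "L n \<omega> \<le> center n + K * \<sigma> n"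
          then have "2 * L n \<omega> \<le> ?N * a n + 2 * (K * \<sigma> n)"
            by (simp add: center_def)
          also have "\<dots> \<le> ?N * a n + ?N * a n * (c - 1) / 2" using K_le by simp
          also have "\<dots> = ?N * (c * a n) - ?t" by (simp add: field_simps)
          finally show "2 * L n \<omega> \<le> ?N * (c * a n) - ?t" .
        qed
      qed (use L_meas in measurable)
      also have "\<dots> \<le> ?N * (2 * (m * kernel_mass d (2 * \<beta>) (r n)) + 4 * real n * (m * a n)\<^sup>2) / ?t\<^sup>2"
        unfolding L_def a_def d_def
        using edge_functional_lower_tail[of m "r n" \<delta> \<beta> ?t c] m r elim \<beta> t c \<delta>(2)
        by (simp add: a_def d_def g_def)
      also have "\<dots> \<le> ?b n"
        using relative_variance_bound[OF n(2) a \<sigma> m(1) c(1)] test_scale_square[OF \<beta>'(1), of n "r n"] n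
        by (simp add: snr_def \<sigma>_def)
      finally show ?case .
    qed
  qed (auto intro!: always_eventually)
  have ev: "eventually (\<lambda>n. \<sigma> n > 0 \<and>
      1 / 2 * real n * (real n - 1) * (LINT (x, y):W \<times> W|lebesgue. edge_term \<beta> (r n) x y) \<le> center n) sequentially"
    using eventually_ge_at_top[of 2]
  proof eventually_elim
    case (elim n)
    then have r: "r n > 0" using r_pos by simp
    have "(LINT (x, y):W \<times> W|lebesgue. edge_term \<beta> (r n) x y) \<le> a n"
      unfolding a_def d_def using \<beta>'(2) r
      by (intro set_integral_edge_term_le W_meas W_vol) (auto simp: d_def)
    then show ?case
      using elim test_scale_pos[OF d \<beta>'(1) r] by (auto simp: \<sigma>_def center_def intro!: mult_left_mono)
  qed
  have "tends_to_infinity_in_prob M (\<lambda>n \<omega>. ((L n \<omega> -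
      1 / 2 * real n * (real n - 1) * (LINT (x, y):W \<times> W|lebesgue. edge_term \<beta> (r n) x y)) / \<sigma> n)\<^sup>2)"
    by (rule standardized_square_tends_to_infinity[OF L_meas tail]) (use ev in \<open>auto elim: eventually_mono\<close>)
  moreover have "tends_to_infinity_in_prob M (\<lambda>n \<omega>. ((L n \<omega> - center n) / \<sigma> n)\<^sup>2)"
    by (rule standardized_square_tends_to_infinity[OF L_meas tail]) (use ev in \<open>auto elim: eventually_mono\<close>)
  moreover have "center n = real d * unit_ball_vol (real d) / (2 * (\<beta> + real d)) *
      real n * (real n - 1) * r n powr (\<beta> + real d)" for n
    by (simp add: center_def a_def kernel_mass_def)
  ultimately show ?thesis
    by (simp add: T_e_def T_a_def L_def \<sigma>_def d_def)
qed

end
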